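(* Consider the multi-period stochastic affine game $\operatorname{SAG}_t(X,G)$ where $G\in\mathbb{R}^{m\times m}$ is a $\mathcal{K}^\dagger$-matrix. Suppose that the column sums of $G$ are non-negative, that is, $\sum_{i\in\mathcal{M}}G_{ij}\geq 0$ for all $j\in\mathcal{M}$. Then for any $\mathcal{N}\subseteq\mathcal{M}$, the coalition value $V^{*\mathcal{N}}_t$ exists and $$V^{*\mathcal{N}}_t=\operatorname*{ess\,sup}_{s^{\mathcal{N}}_t\in\mathcal{S}^{\mathcal{N}}_t}\ \operatorname*{ess\,inf}_{s^{-\mathcal{N}}_t\in\mathcal{S}^{-\mathcal{N}}_t}V^{\mathcal{N}}_t(s^{\mathcal{N}}_t,s^{-\mathcal{N}}_t)=\operatorname*{ess\,inf}_{s^{-\mathcal{N}}_t\in\mathcal{S}^{-\mathcal{N}}_t}\ \operatorname*{ess\,sup}_{s^{\mathcal{N}}_t\in\mathcal{S}^{\mathcal{N}}_t}V^{\mathcal{N}}_t(s^{\mathcal{N}}_t,s^{-\mathcal{N}}_t)=\sum_{i\in\mathcal{N}}V^{*i}_t.$$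
   Context: Matrices. A real square matrix is a $\mathcal{P}^\dagger$-matrix if its determinant is non-negative and all its proper principal minors are positive; a $\mathcal{Z}$-matrix if its off-diagonal entries are all non-positive; a $\mathcal{K}^\dagger$-matrix if it is both. For a matrix $G$ and index set $\mathcal{E}$, $G_{k\mathcal{E}}$ is the part of row $k$ with columns in $\mathcal{E}$ and $G_{\mathcal{E}\mathcal{E}}$ is the principal sub-matrix; $x^{\mathcal{E}}$ is the sub-vector of $x$ indexed by $\mathcal{E}$. Multi-period game. Let $\mathcal{M}=\{1,\dots,m\}$ be the set of players. $(\Omega,\mathcal{F},\mathbb{P})$ is a probability space with filtration $\mathbb{F}=\{\mathcal{F}_t:t=0,1,\dots,T\}$, and $X_t=(X^1_t,\dots,X^m_t)$, $t=0,\dots,T$, are $\mathbb{F}$-adapted, integrable (so that all conditional expectations are well defined); $G$ is deterministic. (In)equalities between random variables are understood almost surely. Write $[t,T]=\{t,t+1,\dots,T\}$. For each $t=0,\dots,T$ the stochastic affine game $\operatorname{SAG}_t(X,G)$ is defined recursively, backward in $t$. Strategies of player $k$: the space $\mathcal{S}^k_t$ of $\mathbb{F}$-stopping times with values in $[t,T]$. A strategy profile is $s_t=(s^1_t,\dots,s^m_t)\in\mathcal{S}_t=\prod_k\mathcal{S}^k_t$; put $\widehat s_t=s^1_t\wedge\dots\wedge s^m_t$ and $\mathcal{E}(s_t)=\{i\in\mathcal{M}:s^i_t=\widehat s_t\}$ (a random set). The game stops at $\widehat s_t$; at $T$ everyone must exercise. The outcome is the vector $V_t(s_t)=(V^1_t(s_t),\dots,V^m_t(s_t))$,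 $$V^k_t(s_t)=\mathbb{E}_{\mathbb{P}}\big(X^k_{\widehat s_t}\mathbf{1}_{\{k\in\mathcal{E}(s_t)\}}+\widehat X^k_{\widehat s_t}\mathbf{1}_{\{k\notin\mathcal{E}(s_t)\}}\,\big|\,\mathcal{F}_t\big),$$ where, on $\{\widehat s_t<T\}$, $$\widehat X^k_{\widehat s_t}=V^{*k}_{\widehat s_t+1}+G_{k\,\mathcal{E}(s_t)}\big(G_{\mathcal{E}(s_t)\mathcal{E}(s_t)}\big)^{-1}\big(X^{\mathcal{E}(s_t)}_{\widehat s_t}-V^{*\mathcal{E}(s_t)}_{\widehat s_t+1}\big),$$ and $V^*_u=(V^{*1}_u,\dots,V^{*m}_u)$ is the value of $\operatorname{SAG}_u(X,G)$ for $u=t+1,\dots,T$ (on $\{\widehat s_t=T\}$ all players exercise, so $\widehat X_T$ is irrelevant). The value $V^*_t$ of $\operatorname{SAG}_t(X,G)$ is given by $V^{*k}_t=\operatorname{ess\,sup}_{s^k_t}\operatorname{ess\,inf}_{s^{-k}_t}V^k_t(s^k_t,s^{-k}_t)=\operatorname{ess\,inf}_{s^{-k}_t}\operatorname{ess\,sup}_{s^k_t}V^k_t(s^k_t,s^{-k}_t)$, where $s_t=(s^k_t,s^{-k}_t)$ separates the strategy of player $k$ from those of the others; when $G$ is a $\mathcal{K}^\dagger$-matrix these individual values exist for every $t$ and $k$, so the recursive definition makes sense. Coalitions. For $\mathcal{N}\subseteq\mathcal{M}$ put $V^{\mathcal{N}}_t(s_t)=\sum_{i\in\mathcal{N}}V^i_t(s_t)$,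 $\mathcal{S}^{\mathcal{N}}_t=\prod_{i\in\mathcal{N}}\mathcal{S}^i_t$, $\mathcal{S}^{-\mathcal{N}}_t=\prod_{i\notin\mathcal{N}}\mathcal{S}^i_t$, and write $s_t=(s^{\mathcal{N}}_t,s^{-\mathcal{N}}_t)$. The coalition value $V^{*\mathcal{N}}_t$ exists if the ess sup–ess inf and the ess inf–ess sup of $V^{\mathcal{N}}_t$ coincide, and is then their common value. *)

theory Defs
  imports "HOL-Analysis.Analysis" "HOL-Probability.Probability"
begin

section \<open>Matrix classes and principal sub-matrices\<close>

text \<open>The determinant of the sub-matrix with rows and columns in \<open>E\<close>: the Leibniz formula of
  \<open>det\<close>, with the index type replaced by \<open>E\<close>.\<close>

definition principal_minor :: "real^'n^'n \<Rightarrow> 'n set \<Rightarrow> real" where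
  "principal_minor G E = (\<Sum>p | p permutes E. of_int (sign p) * (\<Prod>i\<in>E. G $ i $ p i))"

lemma principal_minor_UNIV: "principal_minor G UNIV = det G"
  by (simp add: principal_minor_def det_def)

text \<open>The inverse of the sub-matrix with rows and columns in \<open>E\<close>, defined as \<open>matrix_inv\<close> is;
  only the entries \<open>B i j\<close> with \<open>i, j \<in> E\<close> are meaningful.\<close>

definition principal_inv :: "real^'n^'n \<Rightarrow> 'n set \<Rightarrow> 'n \<Rightarrow> 'n \<Rightarrow> real" where
  "principal_inv G E = (SOME B. \<forall>i\<in>E. \<forall>j\<in>E.
     (\<Sum>l\<in>E. G $ i $ l * B l j) = (if i = j then 1 else 0) \<and>
     (\<Sum>l\<in>E. B i l * G $ l $ j) = (if i = j then 1 else 0))"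

definition P_dagger_matrix :: "real^'n^'n \<Rightarrow> bool" where
  "P_dagger_matrix G \<longleftrightarrow> 0 \<le> det G \<and> (\<forall>E. E \<noteq> {} \<longrightarrow> E \<noteq> UNIV \<longrightarrow> 0 < principal_minor G E)"

definition Z_matrix :: "real^'n^'n \<Rightarrow> bool" where
  "Z_matrix G \<longleftrightarrow> (\<forall>i j. i \<noteq> j \<longrightarrow> G $ i $ j \<le> 0)"

definition K_dagger_matrix :: "real^'n^'n \<Rightarrow> bool" where
  "K_dagger_matrix G \<longleftrightarrow> P_dagger_matrix G \<and> Z_matrix G"


section \<open>Essential suprema and infima of families of random variables\<close>

text \<open>The library's \<open>esssup\<close> is the essential supremum of a single function. Here \<open>\<Phi>\<close> is a family of
  extended real random variables, and the result is the least random variable dominating every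
  member of \<open>\<Phi>\<close> almost surely. For families of random variables on a probability space it exists
  and is unique up to null sets; \<open>ess_sup\<close> picks an arbitrary version.\<close>

definition is_ess_sup :: "'a measure \<Rightarrow> ('a \<Rightarrow> ereal) set \<Rightarrow> ('a \<Rightarrow> ereal) \<Rightarrow> bool" where
  "is_ess_sup M \<Phi> Y \<longleftrightarrow> Y \<in> borel_measurable M \<and> (\<forall>\<phi>\<in>\<Phi>. AE \<omega> in M. \<phi> \<omega> \<le> Y \<omega>) \<and>
     (\<forall>Z\<in>borel_measurable M. (\<forall>\<phi>\<in>\<Phi>. AE \<omega> in M. \<phi> \<omega> \<le> Z \<omega>) \<longrightarrow> (AE \<omega> in M. Y \<omega> \<le> Z \<omega>))"

definition is_ess_inf :: "'a measure \<Rightarrow> ('a \<Rightarrow> ereal) set \<Rightarrow> ('a \<Rightarrow> ereal) \<Rightarrow> bool" where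
  "is_ess_inf M \<Phi> Y \<longleftrightarrow> Y \<in> borel_measurable M \<and> (\<forall>\<phi>\<in>\<Phi>. AE \<omega> in M. Y \<omega> \<le> \<phi> \<omega>) \<and>
     (\<forall>Z\<in>borel_measurable M. (\<forall>\<phi>\<in>\<Phi>. AE \<omega> in M. Z \<omega> \<le> \<phi> \<omega>) \<longrightarrow> (AE \<omega> in M. Z \<omega> \<le> Y \<omega>))"

definition ess_sup :: "'a measure \<Rightarrow> ('a \<Rightarrow> ereal) set \<Rightarrow> 'a \<Rightarrow> ereal" where
  "ess_sup M \<Phi> = (SOME Y. is_ess_sup M \<Phi> Y)"

definition ess_inf :: "'a measure \<Rightarrow> ('a \<Rightarrow> ereal) set \<Rightarrow> 'a \<Rightarrow> ereal" where
  "ess_inf M \<Phi> = (SOME Y. is_ess_inf M \<Phi> Y)"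

text \<open>\<open>J a b\<close> is the payoff when the maximizer plays \<open>a \<in> A\<close> and the minimizer plays \<open>b \<in> B\<close>.\<close>

definition sup_inf :: "'a measure \<Rightarrow> 'b set \<Rightarrow> 'c set \<Rightarrow> ('b \<Rightarrow> 'c \<Rightarrow> 'a \<Rightarrow> real) \<Rightarrow> 'a \<Rightarrow> ereal" where
  "sup_inf M A B J = ess_sup M ((\<lambda>a. ess_inf M ((\<lambda>b \<omega>. ereal (J a b \<omega>)) ` B)) ` A)"

definition inf_sup :: "'a measure \<Rightarrow> 'b set \<Rightarrow> 'c set \<Rightarrow> ('b \<Rightarrow> 'c \<Rightarrow> 'a \<Rightarrow> real) \<Rightarrow> 'a \<Rightarrow> ereal" where
  "inf_sup M A B J = ess_inf M ((\<lambda>b. ess_sup M ((\<lambda>a \<omega>. ereal (J a b \<omega>)) ` A)) ` B)"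


section \<open>The stochastic affine game\<close>

text \<open>The players are the elements of the finite type \<open>'n\<close>. The filtration \<open>F\<close> is indexed by all of
  \<open>nat\<close>, as the library's \<open>stopping_time\<close> requires, but only times up to \<open>T\<close> play a role.\<close>

definition strategies :: "'a measure \<Rightarrow> (nat \<Rightarrow> 'a measure) \<Rightarrow> nat \<Rightarrow> nat \<Rightarrow> ('a \<Rightarrow> nat) set" where
  "strategies M F T t = {\<tau>. stopping_time F \<tau> \<and> (\<forall>\<omega>\<in>space M. t \<le> \<tau> \<omega> \<and> \<tau> \<omega> \<le> T)}"

definition first_exercise :: "('n::finite \<Rightarrow> 'a \<Rightarrow> nat) \<Rightarrow> 'a \<Rightarrow> nat" where
  "first_exercise s \<omega> = Min (range (\<lambda>i. s i \<omega>))"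

definition exercisers :: "('n::finite \<Rightarrow> 'a \<Rightarrow> nat) \<Rightarrow> 'a \<Rightarrow> 'n set" where
  "exercisers s \<omega> = {i. s i \<omega> = first_exercise s \<omega>}"

text \<open>\<open>affine_payoff G E x v k\<close> is \<open>v\<^sup>k + G\<^bsub>kE\<^esub> (G\<^bsub>EE\<^esub>)\<^sup>-\<^sup>1 (x\<^sup>E - v\<^sup>E)\<close>.\<close>

definition affine_payoff :: "real^'n^'n \<Rightarrow> 'n set \<Rightarrow> real^'n \<Rightarrow> real^'n \<Rightarrow> 'n \<Rightarrow> real" where
  "affine_payoff G E x v k =
     v $ k + (\<Sum>i\<in>E. G $ k $ i * (\<Sum>j\<in>E. principal_inv G E i j * (x $ j - v $ j)))"

text \<open>The outcome of a game in which \<open>W u\<close> is the continuation value at time \<open>u\<close>. On the event that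
  the first exercise happens at \<open>T\<close>, all players exercise, so \<open>W (T + 1)\<close> is never used.\<close>

definition outcome_with :: "'a measure \<Rightarrow> (nat \<Rightarrow> 'a measure) \<Rightarrow> (nat \<Rightarrow> 'a \<Rightarrow> real^'n::finite)
    \<Rightarrow> real^'n^'n \<Rightarrow> (nat \<Rightarrow> 'a \<Rightarrow> real^'n) \<Rightarrow> nat \<Rightarrow> ('n \<Rightarrow> 'a \<Rightarrow> nat) \<Rightarrow> 'n \<Rightarrow> 'a \<Rightarrow> real" where
  "outcome_with M F X G W t s k = real_cond_exp M (F t) (\<lambda>\<omega>.
     let u = first_exercise s \<omega>; E = exercisers s \<omega> in
     if k \<in> E then X u \<omega> $ k
     else affine_payoff G E (X u \<omega>) (W (Suc u) \<omega>) k)"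

text \<open>The vector of values \<open>V\<^sup>*\<^sub>t\<close>, by backward recursion. Its components are defined as
  ess sup ess inf; that they are finite and coincide with ess inf ess sup is not part of the
  definition. The guard \<open>t < u \<and> u \<le> T\<close> is only there for termination, since strategies
  take values in \<open>{t..T}\<close>.\<close>

function sag_value :: "'a measure \<Rightarrow> (nat \<Rightarrow> 'a measure) \<Rightarrow> nat \<Rightarrow> (nat \<Rightarrow> 'a \<Rightarrow> real^'n::finite)
    \<Rightarrow> real^'n^'n \<Rightarrow> nat \<Rightarrow> 'a \<Rightarrow> real^'n" where
  "sag_value M F T X G t =
     (let W = (\<lambda>u. if t < u \<and> u \<le> T then sag_value M F T X G u else (\<lambda>_. 0)) in
      (\<lambda>\<omega>. \<chi> k. real_of_ereal
        (sup_inf M (strategies M F T t) (PiE (- {k}) (\<lambda>_. strategies M F T t))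
          (\<lambda>\<tau> s. outcome_with M F X G W t (s(k := \<tau>)) k) \<omega>)))"
  by auto
termination
  by (relation "Wellfounded.measure (\<lambda>(M, F, T, X, G, t). T - t)") auto

declare sag_value.simps [simp del]

definition sag_outcome :: "'a measure \<Rightarrow> (nat \<Rightarrow> 'a measure) \<Rightarrow> nat \<Rightarrow> (nat \<Rightarrow> 'a \<Rightarrow> real^'n::finite)
    \<Rightarrow> real^'n^'n \<Rightarrow> nat \<Rightarrow> ('n \<Rightarrow> 'a \<Rightarrow> nat) \<Rightarrow> 'n \<Rightarrow> 'a \<Rightarrow> real" where
  "sag_outcome M F T X G = outcome_with M F X G (sag_value M F T X G)"


section \<open>Coalitions\<close>

definition coalition_strategies ::
    "'a measure \<Rightarrow> (nat \<Rightarrow> 'a measure) \<Rightarrow> nat \<Rightarrow> nat \<Rightarrow> 'n set \<Rightarrow> ('n \<Rightarrow> 'a \<Rightarrow> nat) set" where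
  "coalition_strategies M F T t N = PiE N (\<lambda>_. strategies M F T t)"

definition coalition_outcome :: "'a measure \<Rightarrow> (nat \<Rightarrow> 'a measure) \<Rightarrow> nat
    \<Rightarrow> (nat \<Rightarrow> 'a \<Rightarrow> real^'n::finite) \<Rightarrow> real^'n^'n \<Rightarrow> nat \<Rightarrow> 'n set
    \<Rightarrow> ('n \<Rightarrow> 'a \<Rightarrow> nat) \<Rightarrow> ('n \<Rightarrow> 'a \<Rightarrow> nat) \<Rightarrow> 'a \<Rightarrow> real" where
  "coalition_outcome M F T X G t N a b \<omega> =
     (\<Sum>i\<in>N. sag_outcome M F T X G t (override_on b a N) i \<omega>)"

definition coalition_sup_inf :: "'a measure \<Rightarrow> (nat \<Rightarrow> 'a measure) \<Rightarrow> nat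
    \<Rightarrow> (nat \<Rightarrow> 'a \<Rightarrow> real^'n::finite) \<Rightarrow> real^'n^'n \<Rightarrow> nat \<Rightarrow> 'n set \<Rightarrow> 'a \<Rightarrow> ereal" where
  "coalition_sup_inf M F T X G t N =
     sup_inf M (coalition_strategies M F T t N) (coalition_strategies M F T t (- N))
       (coalition_outcome M F T X G t N)"

definition coalition_inf_sup :: "'a measure \<Rightarrow> (nat \<Rightarrow> 'a measure) \<Rightarrow> nat
    \<Rightarrow> (nat \<Rightarrow> 'a \<Rightarrow> real^'n::finite) \<Rightarrow> real^'n^'n \<Rightarrow> nat \<Rightarrow> 'n set \<Rightarrow> 'a \<Rightarrow> ereal" where
  "coalition_inf_sup M F T X G t N =
     inf_sup M (coalition_strategies M F T t N) (coalition_strategies M F T t (- N))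
       (coalition_outcome M F T X G t N)"

end

theory Submission
  imports Defs
begin

text \<open>For a single stage with exercise payoffs \<open>x\<close> and continuation values \<open>v\<close>, let \<open>w\<^sup>k\<close> be the larger
  of \<open>x\<^sup>k\<close> and the smallest payoff \<open>k\<close> can be given when not exercising. Player \<open>k\<close> secures \<open>w\<^sup>k\<close>
  alone, by exercising exactly when \<open>w\<^sup>k = x\<^sup>k\<close>. On the other hand, non-negative column sums imply that
  the payoffs of all players never add up to more than \<open>\<Sum>k. w\<^sup>k\<close>. Both bounds pass to the
  multi-period game along the process \<open>U\<close> obtained by iterating \<open>w\<close> backward from \<open>X\<^sub>T\<close>. So a coalition
  secures the sum of its members' values, and its complement does the same, which leaves the
  coalition no more than that sum: the players' individual optimal strategies form a saddle point
  for every coalition.\<close>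

section \<open>Inverses of principal sub-matrices\<close>

text \<open>In a single stage, the payoffs for a proper exercise set form a vector
  \<open>v + G z\<close> with \<open>z\<close> supported on that set. The upper bound on their sum
  rests on some \<open>y \<ge> 0\<close> with \<open>v + G y \<le> w\<close>: summing the rows of
  \<open>G y\<close> pairs \<open>y\<close> with the column sums, which is how their sign enters.
  Such a \<open>y\<close> cannot come from inverting \<open>G\<close>, whose determinant may vanish.
  Only proper sub-matrices are inverted, and the full set is treated apart.

  Over several periods, the payoff at \<open>u\<close> contains the value at \<open>u + 1\<close>,
  whereas the single-stage bounds need a quantity known at \<open>u\<close>. The payoff is affine in
  the continuation value, with coefficients determined by who exercises, and this is known at
  \<open>u\<close>. Conditioning therefore replaces \<open>U (Suc u)\<close> by its conditional
  expectation \<open>P u\<close>.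

  \<open>sag_value\<close> is built from arbitrary versions of essential suprema, so it is
  identified with \<open>U\<close> only almost surely, by backward induction. The individual values
  needed there are those of one-player coalitions.\<close>

definition principal_block :: "real^'n^'n \<Rightarrow> 'n set \<Rightarrow> real^'n^'n" where
  "principal_block G E = (\<chi> i j. if i \<in> E \<and> j \<in> E then G $ i $ j else if i = j then 1 else 0)"

text \<open>Padding by the identity keeps the index type, so that \<open>det\<close> and
  \<open>invertible\<close> apply to sub-matrices. A permutation that moves a point outside
  \<open>E\<close> meets a zero of the padding.\<close>

lemma det_principal_block: "det (principal_block G E) = principal_minor G E"
proof -
  have "det (principal_block G E) = (\<Sum>p | p permutes E.
      of_int (sign p) * (\<Prod>i\<in>UNIV. principal_block G E $ i $ p i))"
    unfolding det_def
  proof (rule sum.mono_neutral_right)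
    show "\<forall>p\<in>{p. p permutes UNIV} - {p. p permutes E}.
        of_int (sign p) * (\<Prod>i\<in>UNIV. principal_block G E $ i $ p i) = 0"
    proof
      fix p assume p: "p \<in> {p. p permutes UNIV} - {p. p permutes E}"
      then obtain i where "i \<notin> E" "p i \<noteq> i"
        by (auto simp: permutes_def)
      then have "principal_block G E $ i $ p i = 0"
        by (auto simp: principal_block_def)
      then have "(\<Prod>i\<in>UNIV. principal_block G E $ i $ p i) = 0"
        by (intro prod_zero) auto
      then show "of_int (sign p) * (\<Prod>i\<in>UNIV. principal_block G E $ i $ p i) = 0" by simp
    qed
  qed (auto intro: permutes_subset)
  also have "\<dots> = principal_minor G E"
    unfolding principal_minor_def
  proof (rule sum.cong)
    fix p assume "p \<in> {p. p permutes E}"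
    then have p: "p permutes E" by simp
    have "(\<Prod>i\<in>UNIV. principal_block G E $ i $ p i) = (\<Prod>i\<in>E. principal_block G E $ i $ p i)"
      using p by (intro prod.mono_neutral_right) (auto simp: principal_block_def permutes_not_in)
    also have "\<dots> = (\<Prod>i\<in>E. G $ i $ p i)"
      using p by (intro prod.cong) (auto simp: principal_block_def permutes_in_image)
    finally show "of_int (sign p) * (\<Prod>i\<in>UNIV. principal_block G E $ i $ p i) =
        of_int (sign p) * (\<Prod>i\<in>E. G $ i $ p i)" by simp
  qed simp
  finally show ?thesis .
qed

lemma principal_minor_empty: "principal_minor G {} = 1"
  by (simp add: principal_minor_def)

lemma principal_inv:
  fixes G :: "real^'n^'n"
  assumes "principal_minor G E \<noteq> 0" "i \<in> E" "j \<in> E"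
  shows "(\<Sum>l\<in>E. G $ i $ l * principal_inv G E l j) = (if i = j then 1 else 0)"
    and "(\<Sum>l\<in>E. principal_inv G E i l * G $ l $ j) = (if i = j then 1 else 0)"
proof -
  let ?A = "principal_block G E"
  have "invertible ?A"
    using assms(1) by (simp add: invertible_det_nz det_principal_block)
  then obtain B where inv: "?A ** B = mat 1" "B ** ?A = mat 1"
    unfolding invertible_def by blast
  have "\<exists>B. \<forall>i\<in>E. \<forall>j\<in>E.
     (\<Sum>l\<in>E. G $ i $ l * B l j) = (if i = j then 1 else 0) \<and>
     (\<Sum>l\<in>E. B i l * G $ l $ j) = (if i = j then 1 else 0)"
  proof (intro exI[of _ "\<lambda>i j. B $ i $ j"] ballI conjI)
    fix i j assume ij: "i \<in> E" "j \<in> E"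
    have "(\<Sum>l\<in>E. G $ i $ l * B $ l $ j) = (\<Sum>l\<in>UNIV. ?A $ i $ l * B $ l $ j)"
      using ij by (intro sum.mono_neutral_cong_left) (auto simp: principal_block_def)
    also have "\<dots> = (?A ** B) $ i $ j" by (simp add: matrix_matrix_mult_def)
    also have "\<dots> = (if i = j then 1 else 0)" by (simp add: inv mat_def)
    finally show "(\<Sum>l\<in>E. G $ i $ l * B $ l $ j) = (if i = j then 1 else 0)" .
    have "(\<Sum>l\<in>E. B $ i $ l * G $ l $ j) = (\<Sum>l\<in>UNIV. B $ i $ l * ?A $ l $ j)"
      using ij by (intro sum.mono_neutral_cong_left) (auto simp: principal_block_def)
    also have "\<dots> = (B ** ?A) $ i $ j" by (simp add: matrix_matrix_mult_def)
    also have "\<dots> = (if i = j then 1 else 0)" by (simp add: inv mat_def)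
    finally show "(\<Sum>l\<in>E. B $ i $ l * G $ l $ j) = (if i = j then 1 else 0)" .
  qed
  from someI_ex[OF this] assms(2,3)
  show "(\<Sum>l\<in>E. G $ i $ l * principal_inv G E l j) = (if i = j then 1 else 0)"
    and "(\<Sum>l\<in>E. principal_inv G E i l * G $ l $ j) = (if i = j then 1 else 0)"
    unfolding principal_inv_def by blast+
qed

lemma principal_minor_insert:
  fixes G :: "real^'n^'n"
  assumes j: "j \<notin> D" and a: "\<And>k. k \<in> D \<Longrightarrow> (\<Sum>i\<in>D. a i * G $ i $ k) = G $ j $ k"
  shows "principal_minor G (insert j D) =
    (G $ j $ j - (\<Sum>i\<in>D. a i * G $ i $ j)) * principal_minor G D"
proof -
  define A where "A = principal_block G (insert j D)"
  define s where "s = G $ j $ j - (\<Sum>i\<in>D. a i * G $ i $ j)"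
  define x where "x = - (\<Sum>i\<in>D. a i *s row i A)"
  define C where "C = (\<chi> k. if k = j then axis j 1 else row k A)"
  have "x \<in> vec.span {row k A |k. k \<noteq> j}"
    unfolding x_def using j
    by (intro vec.span_neg vec.span_sum vec.span_scale vec.span_base) auto
  then have "det A = det (\<chi> k. if k = j then row j A + x else row k A)"
    by (simp add: det_row_span)
  also have "row j A + x = s *s axis j 1"
  proof -
    have "(row j A + x) $ k = (s *s axis j 1) $ k" for k
    proof -
      have "(row j A + x) $ k = A $ j $ k - (\<Sum>i\<in>D. a i * A $ i $ k)"
        by (simp add: x_def row_def)
      moreover have "(\<Sum>i\<in>D. a i * A $ i $ k) = (\<Sum>i\<in>D. a i * G $ i $ k)" if "k \<in> insert j D"
        using that by (intro sum.cong) (auto simp: A_def principal_block_def)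
      moreover have "(\<Sum>i\<in>D. a i * A $ i $ k) = 0" if "k \<notin> insert j D"
        using that by (intro sum.neutral) (auto simp: A_def principal_block_def)
      ultimately show ?thesis
        using a[of k] j by (auto simp: s_def axis_def A_def principal_block_def)
    qed
    then show ?thesis by (simp add: vec_eq_iff)
  qed
  also have "det (\<chi> k. if k = j then s *s axis j 1 else row k A) = s * det C"
    unfolding C_def by (rule det_row_mul)
  \<comment> \<open>Column \<open>j\<close> of \<open>C\<close> may still have entries in the rows
    of \<open>D\<close>. Since row \<open>j\<close> is a unit vector, only permutations fixing
    \<open>j\<close> contribute, and these never meet such entries.\<close>
  also have "det C = det (principal_block G D)"
    unfolding det_def
  proof (rule sum.cong)
    fix p :: "'n \<Rightarrow> 'n" assume "p \<in> {p. p permutes UNIV}"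
    then have inj: "inj p" by (auto simp: permutes_inj)
    have "(\<Prod>i\<in>UNIV. C $ i $ p i) = (\<Prod>i\<in>UNIV. principal_block G D $ i $ p i)"
    proof (cases "p j = j")
      case True
      have "C $ i $ p i = principal_block G D $ i $ p i" for i
      proof (cases "i = j")
        case False
        then have "p i \<noteq> j" using True inj by (metis injD)
        then show ?thesis using False
          by (auto simp: C_def A_def row_def principal_block_def)
      qed (use True j in \<open>auto simp: C_def axis_def principal_block_def\<close>)
      then show ?thesis by simp
    next
      case False
      then have "C $ j $ p j = 0" "principal_block G D $ j $ p j = 0"
        using j by (auto simp: C_def axis_def principal_block_def)
      then have "(\<Prod>i\<in>UNIV. C $ i $ p i) = 0" "(\<Prod>i\<in>UNIV. principal_block G D $ i $ p i) = 0"
        by (auto intro!: prod_zero)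
      then show ?thesis by (simp only:)
    qed
    then show "of_int (sign p) * (\<Prod>i\<in>UNIV. C $ i $ p i) =
        of_int (sign p) * (\<Prod>i\<in>UNIV. principal_block G D $ i $ p i)" by simp
  qed simp
  finally show ?thesis
    by (simp add: A_def det_principal_block s_def)
qed

text \<open>Induction on \<open>E\<close>: eliminating all unknowns but \<open>u j\<close> leaves the Schur complement of
  \<open>E - {j}\<close>, a quotient of two principal minors, as the coefficient of \<open>u j\<close>.\<close>

lemma Z_matrix_inverse_monotone:
  fixes G :: "real^'n^'n"
  assumes Z: "Z_matrix G" and "\<And>D. D \<subseteq> E \<Longrightarrow> D \<noteq> {} \<Longrightarrow> 0 < principal_minor G D"
    and "\<And>i. i \<in> E \<Longrightarrow> 0 \<le> (\<Sum>l\<in>E. G $ i $ l * u l)" and "j \<in> E"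
  shows "0 \<le> u j"
proof -
  have "finite E" by simp
  then show ?thesis using assms(2-)
  proof (induction E arbitrary: u j rule: finite_psubset_induct)
    case (psubset E)
    define D where "D = E - {j}"
    have E: "E = insert j D" and j: "j \<notin> D" using psubset.prems(3) by (auto simp: D_def)
    have minor: "0 < principal_minor G D"
      using psubset.prems(1)[of D] E by (cases "D = {}") (auto simp: principal_minor_empty)
    let ?B = "principal_inv G D"
    \<comment> \<open>\<open>G\<close> restricted to \<open>D\<close> maps column \<open>i\<close>
      of the inverse to a unit vector, so the induction hypothesis for \<open>D\<close> applies to
      that column.\<close>
    have B: "0 \<le> ?B l i" if "l \<in> D" "i \<in> D" for l i
    proof (rule psubset.IH[of D "\<lambda>l. ?B l i"])
      show "D \<subset> E" using E j by auto
      show "0 < principal_minor G D'" if "D' \<subseteq> D" "D' \<noteq> {}" for D'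
        using that psubset.prems(1)[of D'] by (auto simp: D_def)
      show "0 \<le> (\<Sum>l\<in>D. G $ k $ l * ?B l i)" if "k \<in> D" for k
        using principal_inv(1)[of G D k i] minor that \<open>i \<in> D\<close> by auto
    qed (fact that)
    define a where "a i = (\<Sum>l\<in>D. G $ j $ l * ?B l i)" for i
    have a_le: "a i \<le> 0" if "i \<in> D" for i
      unfolding a_def using B[OF _ that] Z j
      by (intro sum_nonpos mult_nonpos_nonneg) (metis Z_matrix_def)+
    have a: "(\<Sum>i\<in>D. a i * G $ i $ k) = G $ j $ k" if "k \<in> D" for k
    proof -
      have "(\<Sum>i\<in>D. a i * G $ i $ k) = (\<Sum>l\<in>D. G $ j $ l * (\<Sum>i\<in>D. ?B l i * G $ i $ k))"
        unfolding a_def sum_distrib_left sum_distrib_right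
        by (subst sum.swap) (simp add: mult_ac)
      also have "\<dots> = (\<Sum>l\<in>D. if l = k then G $ j $ k else 0)"
        using minor that by (intro sum.cong) (auto simp: principal_inv(2))
      finally show ?thesis using that by simp
    qed
    define s where "s = G $ j $ j - (\<Sum>i\<in>D. a i * G $ i $ j)"
    have "principal_minor G E = s * principal_minor G D"
      unfolding E s_def using j a by (rule principal_minor_insert)
    moreover have "0 < principal_minor G E" using psubset.prems by auto
    ultimately have s: "0 < s" using minor by (simp add: zero_less_mult_iff)
    have "s * u j = (\<Sum>l\<in>E. G $ j $ l * u l) - (\<Sum>i\<in>D. a i * (\<Sum>l\<in>E. G $ i $ l * u l))"
    proof -
      have "(\<Sum>i\<in>D. a i * (\<Sum>l\<in>E. G $ i $ l * u l)) =
          (\<Sum>l\<in>E. (\<Sum>i\<in>D. a i * G $ i $ l) * u l)"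
        unfolding sum_distrib_left sum_distrib_right by (subst sum.swap) (simp add: mult_ac)
      then show ?thesis
        using j a by (simp add: E s_def algebra_simps)
    qed
    also have "\<dots> \<ge> 0"
    proof -
      have "(\<Sum>i\<in>D. a i * (\<Sum>l\<in>E. G $ i $ l * u l)) \<le> 0"
        using a_le psubset.prems(2) by (intro sum_nonpos mult_nonpos_nonneg) (auto simp: D_def)
      moreover have "0 \<le> (\<Sum>l\<in>E. G $ j $ l * u l)" using psubset.prems(2,3) by auto
      ultimately show ?thesis by simp
    qed
    finally show "0 \<le> u j" using s by (simp add: zero_le_mult_iff)
  qed
qed

section \<open>The single-stage game\<close>

definition stage_payoff :: "real^'n^'n \<Rightarrow> 'n set \<Rightarrow> real^'n \<Rightarrow> real^'n \<Rightarrow> 'n \<Rightarrow> real" where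
  "stage_payoff G E x v k = (if k \<in> E then x $ k else affine_payoff G E x v k)"

text \<open>The minimum includes \<open>E = {}\<close>, where the payoff is \<open>v $ k\<close>.
  Every set in it omits \<open>k\<close> and is therefore proper.\<close>

definition stage_value :: "real^'n^'n \<Rightarrow> real^'n \<Rightarrow> real^'n \<Rightarrow> 'n \<Rightarrow> real" where
  "stage_value G x v k = max (x $ k) (MIN E\<in>{E. k \<notin> E}. affine_payoff G E x v k)"

text \<open>The matrix taking the gains \<open>x - v\<close> to the payoffs in excess of
  \<open>v\<close>. It depends on the exercise set alone, which is what later allows conditioning on
  the present.\<close>

definition payoff_coeff :: "real^'n^'n \<Rightarrow> 'n set \<Rightarrow> 'n \<Rightarrow> 'n \<Rightarrow> real" where
  "payoff_coeff G E k j = (if k \<in> E then if j = k then 1 else 0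
     else if j \<in> E then \<Sum>i\<in>E. G $ k $ i * principal_inv G E i j else 0)"

lemma affine_payoff_coeff:
  assumes "k \<notin> E"
  shows "affine_payoff G E x v k = v $ k + (\<Sum>j\<in>UNIV. payoff_coeff G E k j * (x $ j - v $ j))"
proof -
  have "(\<Sum>i\<in>E. G $ k $ i * (\<Sum>j\<in>E. principal_inv G E i j * (x $ j - v $ j))) =
      (\<Sum>j\<in>E. payoff_coeff G E k j * (x $ j - v $ j))"
    unfolding sum_distrib_left using assms
    by (subst sum.swap) (simp add: payoff_coeff_def sum_distrib_right mult.assoc)
  also have "\<dots> = (\<Sum>j\<in>UNIV. payoff_coeff G E k j * (x $ j - v $ j))"
    using assms by (intro sum.mono_neutral_left) (auto simp: payoff_coeff_def)
  finally show ?thesis by (simp add: affine_payoff_def)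
qed

lemma stage_payoff_coeff:
  "stage_payoff G E x v k = v $ k + (\<Sum>j\<in>UNIV. payoff_coeff G E k j * (x $ j - v $ j))"
proof (cases "k \<in> E")
  case True
  then have "(\<Sum>j\<in>UNIV. payoff_coeff G E k j * (x $ j - v $ j)) =
      (\<Sum>j\<in>UNIV. if j = k then x $ j - v $ j else 0)"
    by (intro sum.cong) (auto simp: payoff_coeff_def)
  with True show ?thesis by (simp add: stage_payoff_def)
qed (simp add: stage_payoff_def affine_payoff_coeff)

lemma stage_value_ge: "x $ k \<le> stage_value G x v k"
  by (simp add: stage_value_def)

lemma stage_value_le_stage_payoff:
  assumes "k \<in> E \<longleftrightarrow> stage_value G x v k = x $ k"
  shows "stage_value G x v k \<le> stage_payoff G E x v k"
proof (cases "k \<in> E")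
  case False
  then have "(MIN E\<in>{E. k \<notin> E}. affine_payoff G E x v k) \<le> affine_payoff G E x v k"
    by (intro Min_le) auto
  moreover have "stage_value G x v k = (MIN E\<in>{E. k \<notin> E}. affine_payoff G E x v k)"
    using False assms by (auto simp: stage_value_def max_def split: if_splits)
  ultimately show ?thesis using False by (simp add: stage_payoff_def)
qed (use assms in \<open>simp add: stage_payoff_def\<close>)

definition exercise_weights :: "real^'n^'n \<Rightarrow> 'n set \<Rightarrow> real^'n \<Rightarrow> 'n \<Rightarrow> real" where
  "exercise_weights G E d i = (if i \<in> E then \<Sum>j\<in>E. principal_inv G E i j * d $ j else 0)"

lemma affine_payoff_weights:
  "affine_payoff G E x v k = v $ k + (\<Sum>l\<in>UNIV. G $ k $ l * exercise_weights G E (x - v) l)"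
proof -
  have "(\<Sum>l\<in>UNIV. G $ k $ l * exercise_weights G E (x - v) l) =
      (\<Sum>l\<in>E. G $ k $ l * (\<Sum>j\<in>E. principal_inv G E l j * (x $ j - v $ j)))"
    by (intro sum.mono_neutral_cong_right) (auto simp: exercise_weights_def)
  then show ?thesis by (simp add: affine_payoff_def)
qed

lemma exercise_weights_solve:
  assumes "principal_minor G E \<noteq> 0" "i \<in> E"
  shows "(\<Sum>l\<in>UNIV. G $ i $ l * exercise_weights G E d l) = d $ i"
proof -
  have "(\<Sum>l\<in>UNIV. G $ i $ l * exercise_weights G E d l) =
      (\<Sum>l\<in>E. G $ i $ l * (\<Sum>j\<in>E. principal_inv G E l j * d $ j))"
    by (intro sum.mono_neutral_cong_right) (auto simp: exercise_weights_def)
  also have "\<dots> = (\<Sum>j\<in>E. (\<Sum>l\<in>E. G $ i $ l * principal_inv G E l j) * d $ j)"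
    unfolding sum_distrib_left sum_distrib_right by (subst sum.swap) (simp add: mult_ac)
  also have "\<dots> = (\<Sum>j\<in>E. if i = j then d $ j else 0)"
    using assms by (intro sum.cong) (auto simp: principal_inv(1))
  finally show ?thesis using assms(2) by simp
qed

lemma sum_UNIV_split:
  fixes f :: "'n::finite \<Rightarrow> real"
  shows "sum f UNIV = sum f E + sum f (- E)"
  using sum.subset_diff[of E UNIV f] by (simp add: Compl_eq_Diff_UNIV add.commute)

section \<open>Single-stage comparison for K-dagger matrices\<close>

locale K_dagger =
  fixes G :: "real^'n^'n"
  assumes K_dagger: "K_dagger_matrix G"
begin

lemma Z: "Z_matrix G"
  using K_dagger by (simp add: K_dagger_matrix_def)

lemma offdiag: "i \<noteq> j \<Longrightarrow> G $ i $ j \<le> 0"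
  using Z by (simp add: Z_matrix_def)

lemma minor_pos: "E \<noteq> UNIV \<Longrightarrow> 0 < principal_minor G E"
  using K_dagger
  by (cases "E = {}") (simp_all add: K_dagger_matrix_def P_dagger_matrix_def principal_minor_empty)

lemma inverse_monotone:
  assumes "E \<noteq> UNIV" "\<And>i. i \<in> E \<Longrightarrow> 0 \<le> (\<Sum>l\<in>E. G $ i $ l * u l)" "j \<in> E"
  shows "0 \<le> u j"
proof (rule Z_matrix_inverse_monotone[OF Z _ assms(2,3)])
  show "0 < principal_minor G D" if "D \<subseteq> E" for D
    using that assms(1) by (intro minor_pos) auto
qed

lemma principal_inv_nonneg:
  assumes "E \<noteq> UNIV" "i \<in> E" "j \<in> E"
  shows "0 \<le> principal_inv G E i j"
proof (rule inverse_monotone[of E "\<lambda>i. principal_inv G E i j"])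
  show "0 \<le> (\<Sum>l\<in>E. G $ k $ l * principal_inv G E l j)" if "k \<in> E" for k
    using principal_inv(1)[of G E k j] minor_pos[OF assms(1)] that assms(3) by simp
qed (fact assms)+

text \<open>In the rows of \<open>E\<close>, the columns outside \<open>E\<close> are off-diagonal,
  so dropping \<open>y\<close> there can only increase \<open>G y\<close>. Thus \<open>y\<close>
  minus the weights has a non-negative image under the sub-matrix on \<open>E\<close>, and inverse
  monotonicity applies.\<close>

lemma weights_le:
  assumes E: "E \<noteq> UNIV" and y: "\<And>i. 0 \<le> y i"
    and d: "\<And>i. i \<in> E \<Longrightarrow> d $ i \<le> (\<Sum>l\<in>UNIV. G $ i $ l * y l)"
  shows "exercise_weights G E d i \<le> y i"
proof (cases "i \<in> E")
  case True
  let ?u = "\<lambda>l. y l - exercise_weights G E d l"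
  have "0 \<le> ?u i"
  proof (rule inverse_monotone[OF E _ True])
    fix k assume k: "k \<in> E"
    have "(\<Sum>l\<in>E. G $ k $ l * exercise_weights G E d l) =
        (\<Sum>l\<in>UNIV. G $ k $ l * exercise_weights G E d l)"
      by (intro sum.mono_neutral_left) (auto simp: exercise_weights_def)
    also have "\<dots> = d $ k"
      using minor_pos[OF E] k by (simp add: exercise_weights_solve)
    also have "\<dots> \<le> (\<Sum>l\<in>UNIV. G $ k $ l * y l)" by (rule d[OF k])
    also have "\<dots> = (\<Sum>l\<in>E. G $ k $ l * y l) + (\<Sum>l\<in>-E. G $ k $ l * y l)"
      by (rule sum_UNIV_split)
    also have "(\<Sum>l\<in>-E. G $ k $ l * y l) \<le> 0"
      using k y by (intro sum_nonpos mult_nonpos_nonneg offdiag) auto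
    finally show "0 \<le> (\<Sum>l\<in>E. G $ k $ l * ?u l)"
      by (simp add: algebra_simps sum_subtractf)
  qed
  then show ?thesis by simp
qed (use y in \<open>simp add: exercise_weights_def\<close>)

text \<open>Among the proper sets with non-negative exercise weights take one of maximal total weight.
  If some \<open>j\<close> outside it still gains by exercising, then adding \<open>j\<close> increases the weights, so by
  maximality \<open>j\<close> is the only player outside it.\<close>

lemma ex_supporting_weights:
  obtains y where "\<And>i. 0 \<le> y i" "\<And>k. v $ k + (\<Sum>l\<in>UNIV. G $ k $ l * y l) \<le> stage_value G x v k"
proof -
  define d where "d = x - v"
  define z where "z E = exercise_weights G E d" for E
  define \<A> where "\<A> = {E. E \<noteq> UNIV \<and> (\<forall>i. 0 \<le> z E i)}"
  have "{} \<in> \<A>" by (auto simp: \<A>_def z_def exercise_weights_def)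
  then have "Max ((\<lambda>E. \<Sum>i\<in>UNIV. z E i) ` \<A>) \<in> (\<lambda>E. \<Sum>i\<in>UNIV. z E i) ` \<A>"
    by (intro Max_in) auto
  then obtain E where E: "E \<in> \<A>" "(\<Sum>i\<in>UNIV. z E i) = Max ((\<lambda>E. \<Sum>i\<in>UNIV. z E i) ` \<A>)"
    by auto
  then have max: "(\<Sum>i\<in>UNIV. z D i) \<le> (\<Sum>i\<in>UNIV. z E i)" if "D \<in> \<A>" for D
    using that by auto
  have proper: "E \<noteq> UNIV" and z_nonneg: "0 \<le> z E i" for i using E by (auto simp: \<A>_def)
  let ?Gz = "\<lambda>k. \<Sum>l\<in>UNIV. G $ k $ l * z E l"
  have eq: "?Gz k = d $ k" if "k \<in> E" for k
    using minor_pos[OF proper] that by (simp add: z_def exercise_weights_solve)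
  have d_le: "d $ k \<le> stage_value G x v k - v $ k" for k
    using stage_value_ge[of x k G v] by (simp add: d_def)
  have "?Gz k \<le> stage_value G x v k - v $ k" for k
  proof (cases "\<exists>j. j \<notin> E \<and> ?Gz j < d $ j")
    case True
    then obtain j where j: "j \<notin> E" "?Gz j < d $ j" by auto
    let ?D = "insert j E"
    have "?D = UNIV"
    proof (rule ccontr)
      assume D: "?D \<noteq> UNIV"
      have le: "z E i \<le> z ?D i" for i
      proof -
        have "0 \<le> z ?D i - z E i" if "i \<in> ?D"
        proof (rule inverse_monotone[OF D _ that])
          fix k assume k: "k \<in> ?D"
          have "(\<Sum>l\<in>?D. G $ k $ l * (z ?D l - z E l)) = (\<Sum>l\<in>UNIV. G $ k $ l * (z ?D l - z E l))"
            by (intro sum.mono_neutral_left) (auto simp: z_def exercise_weights_def)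
          also have "\<dots> = d $ k - ?Gz k"
            using minor_pos[OF D] k
            by (simp add: z_def exercise_weights_solve algebra_simps sum_subtractf)
          also have "\<dots> \<ge> 0" using k eq j by auto
          finally show "0 \<le> (\<Sum>l\<in>?D. G $ k $ l * (z ?D l - z E l))" .
        qed
        then show ?thesis by (cases "i \<in> ?D") (auto simp: z_def exercise_weights_def)
      qed
      moreover from this have "0 \<le> z ?D i" for i
        using z_nonneg[of i] by (rule order_trans[rotated])
      then have "?D \<in> \<A>" using D by (simp add: \<A>_def)
      \<comment> \<open>Equal totals and \<open>z E \<le> z ?D\<close> force the two weight vectors
        to coincide, yet only \<open>z ?D\<close> solves the equation of row
        \<open>j\<close>.\<close>
      ultimately have "(\<Sum>i\<in>UNIV. z ?D i) = (\<Sum>i\<in>UNIV. z E i)"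
        by (intro antisym max sum_mono)
      then have "z ?D i = z E i" for i
        using sum_mono_inv[of "z E" UNIV "z ?D" i, OF sym _ UNIV_I finite] le by simp
      moreover have "(\<Sum>l\<in>UNIV. G $ j $ l * z ?D l) = d $ j"
        using minor_pos[OF D] by (simp add: z_def exercise_weights_solve)
      ultimately show False using j by simp
    qed
    \<comment> \<open>All players but \<open>j\<close> belong to \<open>E\<close>, where equality
      holds, and row \<open>j\<close> falls short of \<open>d $ j\<close>.\<close>
    then have "?Gz k \<le> d $ k" using eq[of k] j by (cases "k = j") auto
    then show ?thesis using d_le[of k] by simp
  next
    case False
    then have Gz_ge: "d $ i \<le> ?Gz i" for i using eq by (cases "i \<in> E") auto
    show ?thesis
    proof (cases "k \<in> E")
      case True
      then show ?thesis using eq d_le by simp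
    next
      case k: False
      \<comment> \<open>No set \<open>D\<close> without \<open>k\<close> has larger weights than
        \<open>z E\<close>. Both weight vectors vanish at \<open>k\<close>, so only the non-positive
        off-diagonal entries of row \<open>k\<close> matter, and they reverse the
        comparison.\<close>
      have "v $ k + ?Gz k \<le> affine_payoff G D x v k" if "k \<notin> D" for D
      proof -
        have D: "D \<noteq> UNIV" using that by auto
        have "z D i \<le> z E i" for i
          unfolding z_def[of D] using Gz_ge by (intro weights_le[OF D] z_nonneg)
        moreover have "z D k = 0" "z E k = 0"
          using k that by (auto simp: z_def exercise_weights_def)
        ultimately have "G $ k $ l * z E l \<le> G $ k $ l * z D l" for l
          using offdiag by (cases "l = k") (auto intro: mult_left_mono_neg)
        then have "?Gz k \<le> (\<Sum>l\<in>UNIV. G $ k $ l * z D l)" by (intro sum_mono)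
        then show ?thesis by (simp add: affine_payoff_weights z_def d_def)
      qed
      then have "v $ k + ?Gz k \<le> (MIN D\<in>{D. k \<notin> D}. affine_payoff G D x v k)"
        by (subst Min_ge_iff) auto
      then show ?thesis by (simp add: stage_value_def)
    qed
  qed
  then show ?thesis using that[of "z E"] z_nonneg by (simp add: algebra_simps)
qed

text \<open>The total payoff of a proper exercise set \<open>E\<close> is \<open>\<Sum>k. v\<^sup>k\<close> plus a combination of the
  gains \<open>x\<^sup>j - v\<^sup>j\<close>, \<open>j \<in> E\<close>, with coefficients \<open>\<Lambda> = c\<^sup>E (G\<^bsub>EE\<^esub>)\<^sup>-\<^sup>1\<close>, where \<open>c\<close> is the vector of column
  sums. Both \<open>\<Lambda>\<close> and \<open>1 - \<Lambda>\<close> are non-negative because \<open>c\<close> is and \<open>G\<close> is a \<open>Z\<close>-matrix.\<close>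

lemma sum_stage_payoff_le:
  assumes col: "\<And>j. 0 \<le> (\<Sum>i\<in>UNIV. G $ i $ j)"
  shows "(\<Sum>k\<in>UNIV. stage_payoff G E x v k) \<le> (\<Sum>k\<in>UNIV. stage_value G x v k)"
proof (cases "E = UNIV")
  case True
  then show ?thesis by (auto simp: stage_payoff_def intro!: sum_mono stage_value_ge)
next
  case E: False
  define c where "c j = (\<Sum>i\<in>UNIV. G $ i $ j)" for j
  have c: "0 \<le> c j" for j using col by (simp add: c_def)
  let ?B = "principal_inv G E"
  define \<Lambda> where "\<Lambda> j = (\<Sum>i\<in>E. c i * ?B i j)" for j
  define d where "d = x - v"
  have minor: "principal_minor G E \<noteq> 0" using minor_pos[OF E] by simp
  have B: "0 \<le> ?B i j" if "i \<in> E" "j \<in> E" for i j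
    using principal_inv_nonneg[OF E that] .
  have \<Lambda>_nonneg: "0 \<le> \<Lambda> j" if "j \<in> E" for j
    unfolding \<Lambda>_def using that by (intro sum_nonneg mult_nonneg_nonneg B c)
  have \<Lambda>_le: "\<Lambda> j \<le> 1" if "j \<in> E" for j
  proof -
    have "c i = (\<Sum>l\<in>E. G $ l $ i) + (\<Sum>l\<in>-E. G $ l $ i)" for i
      unfolding c_def by (rule sum_UNIV_split)
    moreover have "(\<Sum>l\<in>-E. G $ l $ i) \<le> 0" if "i \<in> E" for i
      using that by (intro sum_nonpos offdiag) auto
    ultimately have "c i \<le> (\<Sum>l\<in>E. G $ l $ i)" if "i \<in> E" for i using that by simp
    then have "\<Lambda> j \<le> (\<Sum>i\<in>E. (\<Sum>l\<in>E. G $ l $ i) * ?B i j)"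
      unfolding \<Lambda>_def using that by (intro sum_mono mult_right_mono B)
    also have "\<dots> = (\<Sum>l\<in>E. \<Sum>i\<in>E. G $ l $ i * ?B i j)"
      unfolding sum_distrib_right by (rule sum.swap)
    also have "\<dots> = (\<Sum>l\<in>E. if l = j then 1 else 0)"
      using minor that by (intro sum.cong) (auto simp: principal_inv(1))
    finally show ?thesis using that by simp
  qed
  have \<Lambda>_G: "(\<Sum>i\<in>E. \<Lambda> i * G $ i $ l) \<le> c l" for l
  proof (cases "l \<in> E")
    case True
    have "(\<Sum>i\<in>E. \<Lambda> i * G $ i $ l) = (\<Sum>j\<in>E. c j * (\<Sum>i\<in>E. ?B j i * G $ i $ l))"
      unfolding \<Lambda>_def sum_distrib_left sum_distrib_right
      by (subst sum.swap) (simp add: mult_ac)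
    also have "\<dots> = (\<Sum>j\<in>E. if j = l then c j else 0)"
      using minor True by (intro sum.cong) (auto simp: principal_inv(2))
    finally show ?thesis using True by simp
  next
    case False
    have "(\<Sum>i\<in>E. \<Lambda> i * G $ i $ l) \<le> 0"
      using False by (intro sum_nonpos mult_nonneg_nonpos \<Lambda>_nonneg offdiag) auto
    then show ?thesis using c[of l] by simp
  qed
  obtain y where y: "0 \<le> y i" and y_le: "v $ k + (\<Sum>l\<in>UNIV. G $ k $ l * y l) \<le> stage_value G x v k"
    for i k using ex_supporting_weights[of v x] by metis
  define e where "e k = stage_value G x v k - v $ k" for k
  let ?Gy = "\<lambda>k. \<Sum>l\<in>UNIV. G $ k $ l * y l"
  have Gy: "?Gy k \<le> e k" for k using y_le[of k] by (simp add: e_def)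
  have d: "d $ k \<le> e k" for k using stage_value_ge[of x k G v] by (simp add: d_def e_def)
  have sum_Gu: "(\<Sum>k\<in>UNIV. \<Sum>l\<in>UNIV. G $ k $ l * u l) = (\<Sum>l\<in>UNIV. c l * u l)" for u
    unfolding c_def sum_distrib_right by (rule sum.swap)
  \<comment> \<open>For \<open>k \<in> E\<close> as well: the weights solve row \<open>k\<close>, so
    the affine formula returns \<open>x $ k\<close>.\<close>
  have "stage_payoff G E x v k = affine_payoff G E x v k" for k
    using exercise_weights_solve[OF minor, of k "x - v"]
    by (auto simp: stage_payoff_def affine_payoff_weights)
  then have "(\<Sum>k\<in>UNIV. stage_payoff G E x v k) - (\<Sum>k\<in>UNIV. v $ k) =
      (\<Sum>l\<in>UNIV. c l * exercise_weights G E d l)"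
    by (simp add: affine_payoff_weights sum.distrib sum_Gu d_def)
  also have "\<dots> = (\<Sum>l\<in>E. c l * (\<Sum>j\<in>E. ?B l j * d $ j))"
    by (intro sum.mono_neutral_cong_right) (auto simp: exercise_weights_def)
  also have "\<dots> = (\<Sum>j\<in>E. \<Lambda> j * d $ j)"
    unfolding \<Lambda>_def sum_distrib_left sum_distrib_right by (subst sum.swap) (simp add: mult_ac)
  also have "\<dots> \<le> (\<Sum>j\<in>E. \<Lambda> j * e j)"
    by (intro sum_mono mult_left_mono d \<Lambda>_nonneg)
  \<comment> \<open>The slack \<open>e - G y\<close> is non-negative, so
    \<open>\<Lambda> \<le> 1\<close> allows summing it over all players with weight 1. The remaining
    part is at most the pairing of \<open>c\<close> with \<open>y\<close>, by
    \<open>\<Lambda>_G\<close>. That pairing is the sum of the components of \<open>G y\<close>, so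
    the two bounds add up to the sum of \<open>e\<close>.\<close>
  also have "\<dots> = (\<Sum>j\<in>E. \<Lambda> j * ?Gy j) + (\<Sum>j\<in>E. \<Lambda> j * (e j - ?Gy j))"
    by (simp add: algebra_simps sum.distrib sum_subtractf)
  also have "(\<Sum>j\<in>E. \<Lambda> j * (e j - ?Gy j)) \<le> (\<Sum>j\<in>E. e j - ?Gy j)"
    using Gy \<Lambda>_le by (intro sum_mono mult_left_le_one_le) (auto simp: \<Lambda>_nonneg)
  also have "\<dots> \<le> (\<Sum>j\<in>UNIV. e j - ?Gy j)"
    using Gy by (intro sum_mono2) auto
  also have "(\<Sum>j\<in>E. \<Lambda> j * ?Gy j) = (\<Sum>l\<in>UNIV. (\<Sum>j\<in>E. \<Lambda> j * G $ j $ l) * y l)"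
    unfolding sum_distrib_left sum_distrib_right by (subst sum.swap) (simp add: mult_ac)
  also have "\<dots> \<le> (\<Sum>l\<in>UNIV. c l * y l)"
    using \<Lambda>_G y by (intro sum_mono mult_right_mono) auto
  also have "\<dots> = (\<Sum>k\<in>UNIV. ?Gy k)" by (simp add: sum_Gu)
  finally have "(\<Sum>k\<in>UNIV. stage_payoff G E x v k) - (\<Sum>k\<in>UNIV. v $ k) \<le> (\<Sum>k\<in>UNIV. e k)"
    by (simp add: sum_subtractf)
  then show ?thesis by (simp add: e_def sum_subtractf)
qed

end

section \<open>Essential suprema and saddle points\<close>

lemma ereal_rat_dense:
  fixes x y :: ereal
  assumes "x < y"
  obtains q where "x < ereal (real_of_rat q)" "ereal (real_of_rat q) < y"
proof -
  obtain a where a: "x < ereal a" "ereal a < y" using ereal_dense2[OF assms] by blast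
  obtain b where b: "ereal a < ereal b" "ereal b < y" using ereal_dense2[OF a(2)] by blast
  then obtain q where q: "a < of_rat q" "of_rat q < b" using of_rat_dense[of a b] by auto
  show ?thesis
  proof (rule that[of q])
    show "x < ereal (real_of_rat q)" using a(1) q(1) by (meson ereal_less_eq(3) less_imp_le less_le_trans)
    show "ereal (real_of_rat q) < y" using q(2) b(2) by (meson ereal_less_eq(3) less_imp_le le_less_trans)
  qed
qed

text \<open>Exhaustion: the supremum of the measures of countable unions is attained, since
  countably many countable families merge into one. Adding another \<open>A i\<close> cannot
  increase a maximal finite measure, so it adds only a null set.\<close>

lemma (in finite_measure) ex_essential_union:
  fixes A :: "'i \<Rightarrow> 'a set"
  assumes A: "\<And>i. i \<in> I \<Longrightarrow> A i \<in> sets M"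
  obtains C where "countable C" "C \<subseteq> I" "\<And>i. i \<in> I \<Longrightarrow> A i - (\<Union>j\<in>C. A j) \<in> null_sets M"
proof -
  let ?\<C> = "{C. countable C \<and> C \<subseteq> I}"
  let ?m = "\<lambda>C. emeasure M (\<Union>j\<in>C. A j)"
  have "?\<C> \<noteq> {}" by (auto intro: exI[of _ "{}"])
  from ennreal_SUP_countable_SUP[OF this, of ?m]
  obtain f :: "nat \<Rightarrow> ennreal" where f: "range f \<subseteq> ?m ` ?\<C>" "Sup (?m ` ?\<C>) = Sup (range f)"
    by (elim exE conjE)
  then have "\<forall>n. \<exists>D. D \<in> ?\<C> \<and> f n = ?m D" by (auto simp: image_subset_iff image_iff)
  then obtain D where D: "\<And>n. D n \<in> ?\<C>" "\<And>n. f n = ?m (D n)" by metis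
  define C where "C = (\<Union>n. D n)"
  have C: "countable C" "C \<subseteq> I" using D(1) by (auto simp: C_def)
  have sets: "(\<Union>j\<in>C'. A j) \<in> sets M" if "countable C'" "C' \<subseteq> I" for C'
    using that A by (intro sets.countable_UN') auto
  have ge: "?m C' \<le> ?m C" if "C' \<in> ?\<C>" for C'
  proof -
    have "?m C' \<le> Sup (range f)" unfolding f(2)[symmetric] using that by (rule SUP_upper)
    also have "\<dots> \<le> ?m C"
      unfolding D(2) by (intro SUP_least emeasure_mono sets C) (auto simp: C_def)
    finally show ?thesis .
  qed
  have "A i - (\<Union>j\<in>C. A j) \<in> null_sets M" if i: "i \<in> I" for i
  proof -
    let ?U = "\<Union>j\<in>C. A j"
    have U: "?U \<in> sets M" by (rule sets[OF C])
    have "emeasure M (A i \<union> ?U) \<le> ?m C" using ge[of "insert i C"] C i by simp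
    moreover have "A i \<union> ?U = ?U \<union> (A i - ?U)" by blast
    moreover have "emeasure M (?U \<union> (A i - ?U)) = emeasure M ?U + emeasure M (A i - ?U)"
      using U A[OF i] by (intro plus_emeasure[symmetric]) auto
    ultimately have "emeasure M ?U + emeasure M (A i - ?U) \<le> emeasure M ?U + 0" by simp
    then have "emeasure M (A i - ?U) = 0"
      using emeasure_finite[of ?U] by (simp add: ennreal_add_left_cancel_le)
    then show ?thesis using U A[OF i] by (intro null_setsI) auto
  qed
  with C that show ?thesis by blast
qed

text \<open>For every rational level \<open>q\<close>, countably many superlevel sets \<open>{\<phi> > q}\<close> cover all of them up
  to null sets.\<close>

lemma (in finite_measure) ex_is_ess_sup:
  assumes \<Phi>: "\<Phi> \<subseteq> borel_measurable M"
  shows "\<exists>Y. is_ess_sup M \<Phi> Y"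
proof -
  define A where "A q \<phi> = {\<omega> \<in> space M. ereal (real_of_rat q) < \<phi> \<omega>}" for q and \<phi> :: "'a \<Rightarrow> ereal"
  have A: "A q \<phi> \<in> sets M" if "\<phi> \<in> \<Phi>" for q \<phi>
  proof -
    have [measurable]: "\<phi> \<in> borel_measurable M" using that \<Phi> by auto
    show ?thesis unfolding A_def by measurable
  qed
  have "\<forall>q. \<exists>C. countable C \<and> C \<subseteq> \<Phi> \<and> (\<forall>\<phi>\<in>\<Phi>. A q \<phi> - (\<Union>\<psi>\<in>C. A q \<psi>) \<in> null_sets M)"
    using ex_essential_union[of \<Phi> "A _"] A by metis
  then obtain C where C: "\<And>q. countable (C q)" "\<And>q. C q \<subseteq> \<Phi>"
    "\<And>q \<phi>. \<phi> \<in> \<Phi> \<Longrightarrow> A q \<phi> - (\<Union>\<psi>\<in>C q. A q \<psi>) \<in> null_sets M" by metis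
  define D where "D = (\<Union>q. C q)"
  have D: "countable D" "D \<subseteq> \<Phi>" using C by (auto simp: D_def)
  define Y where "Y \<omega> = (SUP \<psi>\<in>D. \<psi> \<omega>)" for \<omega>
  have "Y \<in> borel_measurable M"
    unfolding Y_def[abs_def] using D \<Phi> by (intro borel_measurable_SUP) auto
  moreover have "AE \<omega> in M. \<phi> \<omega> \<le> Y \<omega>" if "\<phi> \<in> \<Phi>" for \<phi>
  proof -
    have "AE \<omega> in M. \<forall>q. \<omega> \<notin> A q \<phi> - (\<Union>\<psi>\<in>C q. A q \<psi>)"
      unfolding AE_all_countable using C(3)[OF that] AE_not_in by blast
    moreover have "\<phi> \<omega> \<le> Y \<omega>"
      if \<omega>: "\<omega> \<in> space M" "\<forall>q. \<omega> \<notin> A q \<phi> - (\<Union>\<psi>\<in>C q. A q \<psi>)" for \<omega>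
    proof (rule ccontr)
      assume "\<not> \<phi> \<omega> \<le> Y \<omega>"
      then have "Y \<omega> < \<phi> \<omega>" by simp
      then obtain q where q: "Y \<omega> < ereal (real_of_rat q)" "ereal (real_of_rat q) < \<phi> \<omega>"
        by (rule ereal_rat_dense)
      then obtain \<psi> where "\<psi> \<in> C q" "ereal (real_of_rat q) < \<psi> \<omega>"
        using \<omega> by (auto simp: A_def)
      moreover from this have "\<psi> \<omega> \<le> Y \<omega>"
        unfolding Y_def D_def by (intro SUP_upper) auto
      ultimately show False using q(1) by simp
    qed
    ultimately show ?thesis using AE_space by (auto elim: eventually_elim2)
  qed
  moreover have "AE \<omega> in M. Y \<omega> \<le> Z \<omega>"
    if "\<forall>\<phi>\<in>\<Phi>. AE \<omega> in M. \<phi> \<omega> \<le> Z \<omega>" for Z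
  proof -
    have "AE \<omega> in M. \<forall>\<psi>\<in>D. \<psi> \<omega> \<le> Z \<omega>"
      using that D by (simp add: AE_ball_countable subset_eq)
    then show ?thesis by eventually_elim (auto simp: Y_def intro: SUP_least)
  qed
  ultimately show ?thesis unfolding is_ess_sup_def by blast
qed

lemma is_ess_sup_uminus_iff:
  "is_ess_sup M ((\<lambda>\<phi> \<omega>. - \<phi> \<omega>) ` \<Phi>) (\<lambda>\<omega>. - Y \<omega>) \<longleftrightarrow> is_ess_inf M \<Phi> Y"
proof -
  have *: "(\<forall>Z\<in>borel_measurable M. P Z) \<longleftrightarrow> (\<forall>Z\<in>borel_measurable M. P (\<lambda>\<omega>. - Z \<omega>))"
    for P :: "('a \<Rightarrow> ereal) \<Rightarrow> bool"
  proof (intro iffI ballI)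
    fix Z :: "'a \<Rightarrow> ereal"
    assume *: "\<forall>Z\<in>borel_measurable M. P (\<lambda>\<omega>. - Z \<omega>)" and "Z \<in> borel_measurable M"
    then have "(\<lambda>\<omega>. - Z \<omega>) \<in> borel_measurable M" by measurable
    from bspec[OF * this] have "P (\<lambda>\<omega>. - (- Z \<omega>))" .
    then show "P Z" by simp
  qed auto
  show ?thesis
    unfolding is_ess_sup_def is_ess_inf_def by (subst *) simp
qed

lemma (in finite_measure) ex_is_ess_inf:
  assumes \<Phi>: "\<Phi> \<subseteq> borel_measurable M"
  shows "\<exists>Y. is_ess_inf M \<Phi> Y"
proof -
  have "(\<lambda>\<phi> \<omega>. - \<phi> \<omega>) ` \<Phi> \<subseteq> borel_measurable M" using \<Phi> by auto
  then obtain Y where "is_ess_sup M ((\<lambda>\<phi> \<omega>. - \<phi> \<omega>) ` \<Phi>) Y" using ex_is_ess_sup by blast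
  then have "is_ess_inf M \<Phi> (\<lambda>\<omega>. - Y \<omega>)"
    using is_ess_sup_uminus_iff[of M \<Phi> "\<lambda>\<omega>. - Y \<omega>"] by simp
  then show ?thesis by blast
qed

lemma is_ess_sup_upper: "is_ess_sup M \<Phi> Y \<Longrightarrow> \<phi> \<in> \<Phi> \<Longrightarrow> AE \<omega> in M. \<phi> \<omega> \<le> Y \<omega>"
  by (simp add: is_ess_sup_def)

lemma is_ess_inf_lower: "is_ess_inf M \<Phi> Y \<Longrightarrow> \<phi> \<in> \<Phi> \<Longrightarrow> AE \<omega> in M. Y \<omega> \<le> \<phi> \<omega>"
  by (simp add: is_ess_inf_def)

lemma is_ess_sup_least:
  "is_ess_sup M \<Phi> Y \<Longrightarrow> Z \<in> borel_measurable M \<Longrightarrow> (\<And>\<phi>. \<phi> \<in> \<Phi> \<Longrightarrow> AE \<omega> in M. \<phi> \<omega> \<le> Z \<omega>) \<Longrightarrow>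
    AE \<omega> in M. Y \<omega> \<le> Z \<omega>"
  unfolding is_ess_sup_def by blast

lemma is_ess_inf_greatest:
  "is_ess_inf M \<Phi> Y \<Longrightarrow> Z \<in> borel_measurable M \<Longrightarrow> (\<And>\<phi>. \<phi> \<in> \<Phi> \<Longrightarrow> AE \<omega> in M. Z \<omega> \<le> \<phi> \<omega>) \<Longrightarrow>
    AE \<omega> in M. Z \<omega> \<le> Y \<omega>"
  unfolding is_ess_inf_def by blast

lemma ess_supI:
  assumes "is_ess_sup M \<Phi> Y"
  shows "is_ess_sup M \<Phi> (ess_sup M \<Phi>)" and "AE \<omega> in M. ess_sup M \<Phi> \<omega> = Y \<omega>"
proof -
  show *: "is_ess_sup M \<Phi> (ess_sup M \<Phi>)"
    unfolding ess_sup_def using assms by (rule someI[of "is_ess_sup M \<Phi>"])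
  have "AE \<omega> in M. ess_sup M \<Phi> \<omega> \<le> Y \<omega>" "AE \<omega> in M. Y \<omega> \<le> ess_sup M \<Phi> \<omega>"
    using * assms unfolding is_ess_sup_def by blast+
  then show "AE \<omega> in M. ess_sup M \<Phi> \<omega> = Y \<omega>" by eventually_elim simp
qed

lemma ess_infI:
  assumes "is_ess_inf M \<Phi> Y"
  shows "is_ess_inf M \<Phi> (ess_inf M \<Phi>)" and "AE \<omega> in M. ess_inf M \<Phi> \<omega> = Y \<omega>"
proof -
  show *: "is_ess_inf M \<Phi> (ess_inf M \<Phi>)"
    unfolding ess_inf_def using assms by (rule someI[of "is_ess_inf M \<Phi>"])
  have "AE \<omega> in M. ess_inf M \<Phi> \<omega> \<le> Y \<omega>" "AE \<omega> in M. Y \<omega> \<le> ess_inf M \<Phi> \<omega>"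
    using * assms unfolding is_ess_inf_def by blast+
  then show "AE \<omega> in M. ess_inf M \<Phi> \<omega> = Y \<omega>" by eventually_elim simp
qed

section \<open>Values from saddle points\<close>

context finite_measure
begin

text \<open>\<open>a0\<close> secures \<open>w\<close> and \<open>b0\<close> concedes no more, so
  both iterated values are squeezed to \<open>w\<close>. Measurability is recorded because almost
  sure equality with \<open>w\<close> does not imply it, and the backward recursion needs
  it.\<close>

lemma saddle_point_value:
  fixes J :: "'b \<Rightarrow> 'c \<Rightarrow> 'a \<Rightarrow> real" and w :: "'a \<Rightarrow> real"
  assumes J [measurable]: "\<And>a b. J a b \<in> borel_measurable M"
    and w [measurable]: "w \<in> borel_measurable M"
    and a0: "a0 \<in> A" "\<And>b. b \<in> B \<Longrightarrow> AE \<omega> in M. w \<omega> \<le> J a0 b \<omega>"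
    and b0: "b0 \<in> B" "\<And>a. a \<in> A \<Longrightarrow> AE \<omega> in M. J a b0 \<omega> \<le> w \<omega>"
  shows "sup_inf M A B J \<in> borel_measurable M"
    and "AE \<omega> in M. sup_inf M A B J \<omega> = ereal (w \<omega>)"
    and "AE \<omega> in M. inf_sup M A B J \<omega> = ereal (w \<omega>)"
proof -
  let ?inf = "\<lambda>a. ess_inf M ((\<lambda>b \<omega>. ereal (J a b \<omega>)) ` B)"
  let ?sup = "\<lambda>b. ess_sup M ((\<lambda>a \<omega>. ereal (J a b \<omega>)) ` A)"
  \<comment> \<open>\<open>ess_inf\<close> is an arbitrary choice, so its defining property is
    available only once existence is known.\<close>
  have inf: "is_ess_inf M ((\<lambda>b \<omega>. ereal (J a b \<omega>)) ` B) (?inf a)" for a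
  proof -
    have "\<exists>Y. is_ess_inf M ((\<lambda>b \<omega>. ereal (J a b \<omega>)) ` B) Y" by (rule ex_is_ess_inf) auto
    then show ?thesis using ess_infI(1) by blast
  qed
  have sup: "is_ess_sup M ((\<lambda>a \<omega>. ereal (J a b \<omega>)) ` A) (?sup b)" for b
  proof -
    have "\<exists>Y. is_ess_sup M ((\<lambda>a \<omega>. ereal (J a b \<omega>)) ` A) Y" by (rule ex_is_ess_sup) auto
    then show ?thesis using ess_supI(1) by blast
  qed
  have w': "(\<lambda>\<omega>. ereal (w \<omega>)) \<in> borel_measurable M" using w by (rule borel_measurable_ereal)
  have inf_le: "AE \<omega> in M. ?inf a \<omega> \<le> ereal (w \<omega>)" if "a \<in> A" for a
  proof -
    have "AE \<omega> in M. ?inf a \<omega> \<le> ereal (J a b0 \<omega>)"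
      by (rule is_ess_inf_lower[OF inf]) (rule image_eqI[OF refl b0(1)])
    moreover have "AE \<omega> in M. ereal (J a b0 \<omega>) \<le> ereal (w \<omega>)" using b0(2)[OF that] by simp
    ultimately show ?thesis by eventually_elim (rule order_trans)
  qed
  have inf_ge: "AE \<omega> in M. ereal (w \<omega>) \<le> ?inf a0 \<omega>"
    by (rule is_ess_inf_greatest[OF inf w']) (use a0(2) in auto)
  have sup_ge: "AE \<omega> in M. ereal (w \<omega>) \<le> ?sup b \<omega>" if "b \<in> B" for b
  proof -
    have "AE \<omega> in M. ereal (J a0 b \<omega>) \<le> ?sup b \<omega>"
      by (rule is_ess_sup_upper[OF sup]) (rule image_eqI[OF refl a0(1)])
    moreover have "AE \<omega> in M. ereal (w \<omega>) \<le> ereal (J a0 b \<omega>)" using a0(2)[OF that] by simp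
    ultimately show ?thesis by eventually_elim (rule order_trans[rotated])
  qed
  have sup_le: "AE \<omega> in M. ?sup b0 \<omega> \<le> ereal (w \<omega>)"
    by (rule is_ess_sup_least[OF sup w']) (use b0(2) in auto)
  have "is_ess_sup M (?inf ` A) (\<lambda>\<omega>. ereal (w \<omega>))"
    unfolding is_ess_sup_def
  proof (intro conjI ballI impI w')
    show "AE \<omega> in M. ereal (w \<omega>) \<le> Z \<omega>" if "\<forall>\<phi>\<in>?inf ` A. AE \<omega> in M. \<phi> \<omega> \<le> Z \<omega>" for Z
    proof -
      have "AE \<omega> in M. ?inf a0 \<omega> \<le> Z \<omega>" using that a0(1) by blast
      with inf_ge show ?thesis by eventually_elim (rule order_trans)
    qed
  qed (use inf_le in auto)
  from ess_supI[OF this]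
  show "sup_inf M A B J \<in> borel_measurable M" "AE \<omega> in M. sup_inf M A B J \<omega> = ereal (w \<omega>)"
    by (simp_all add: sup_inf_def is_ess_sup_def)
  have "is_ess_inf M (?sup ` B) (\<lambda>\<omega>. ereal (w \<omega>))"
    unfolding is_ess_inf_def
  proof (intro conjI ballI impI w')
    show "AE \<omega> in M. Z \<omega> \<le> ereal (w \<omega>)" if "\<forall>\<phi>\<in>?sup ` B. AE \<omega> in M. Z \<omega> \<le> \<phi> \<omega>" for Z
    proof -
      have "AE \<omega> in M. Z \<omega> \<le> ?sup b0 \<omega>" using that b0(1) by blast
      with sup_le show ?thesis by eventually_elim (rule order_trans)
    qed
  qed (use sup_ge in auto)
  from ess_infI(2)[OF this] show "AE \<omega> in M. inf_sup M A B J \<omega> = ereal (w \<omega>)"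
    by (simp add: inf_sup_def)
qed

end

section \<open>The multi-period game\<close>

lemma integrable_finite_valued_mult:
  fixes f :: "'a \<Rightarrow> real" and g :: "'b::finite \<Rightarrow> real"
  assumes Z: "Z \<in> measurable M (count_space UNIV)" and f: "integrable M f"
  shows "integrable M (\<lambda>\<omega>. g (Z \<omega>) * f \<omega>)"
proof (rule Bochner_Integration.integrable_bound)
  show "integrable M (\<lambda>\<omega>. (\<Sum>z\<in>UNIV. \<bar>g z\<bar>) * f \<omega>)" using f by simp
  have "(\<lambda>\<omega>. g (Z \<omega>)) \<in> borel_measurable M"
    using Z by (rule measurable_compose) simp
  then show "(\<lambda>\<omega>. g (Z \<omega>) * f \<omega>) \<in> borel_measurable M" using f by measurable
  have "\<bar>g z\<bar> \<le> (\<Sum>z\<in>UNIV. \<bar>g z\<bar>)" for z by (rule member_le_sum) auto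
  then show "AE \<omega> in M. norm (g (Z \<omega>) * f \<omega>) \<le> norm ((\<Sum>z\<in>UNIV. \<bar>g z\<bar>) * f \<omega>)"
    by (auto simp: abs_mult sum_nonneg intro!: mult_right_mono)
qed

section \<open>The candidate value process and its stopping rules\<close>

locale affine_game = K_dagger G + prob_space M
  for G :: "real^'n^'n" and M :: "'a measure" +
  fixes F :: "nat \<Rightarrow> 'a measure" and T :: nat and X :: "nat \<Rightarrow> 'a \<Rightarrow> real^'n"
  assumes filtration: "filtration (space M) F"
    and subalgebra_F: "\<And>u. subalgebra M (F u)"
    and X_borel: "\<And>u. u \<le> T \<Longrightarrow> X u \<in> borel_measurable (F u)"
    and X_integrable: "\<And>u. u \<le> T \<Longrightarrow> integrable M (X u)"
    and column_sums: "\<And>j. 0 \<le> (\<Sum>i\<in>UNIV. G $ i $ j)"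
begin

lemma sigma_finite_subalgebra_F: "sigma_finite_subalgebra M (F u)"
  by (intro finite_measure_subalgebra_is_sigma_finite finite_measure_subalgebra.intro
      finite_measure_subalgebra_axioms.intro subalgebra_F finite_measure_axioms)

lemma subalg_mono: "u \<le> v \<Longrightarrow> subalgebra (F v) (F u)"
  using filtration by (simp add: subalgebra_def filtration_def)

lemma X_nth:
  assumes "u \<le> T"
  shows X_nth_borel: "(\<lambda>\<omega>. X u \<omega> $ k) \<in> borel_measurable (F u)"
    and X_nth_integrable: "integrable M (\<lambda>\<omega>. X u \<omega> $ k)"
proof -
  have "(\<lambda>x. x $ k) \<in> borel_measurable (borel :: (real^'n) measure)"
    by (intro borel_measurable_continuous_onI continuous_intros)
  with X_borel[OF assms] show "(\<lambda>\<omega>. X u \<omega> $ k) \<in> borel_measurable (F u)"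
    by (rule measurable_compose)
  show "integrable M (\<lambda>\<omega>. X u \<omega> $ k)"
    by (rule integrable_bounded_linear[OF bounded_linear_vec_nth X_integrable[OF assms]])
qed

text \<open>Indexed by the number \<open>n\<close> of remaining periods, which turns the backward
  recursion into a primitive one; stage \<open>n\<close> belongs to time
  \<open>T - n\<close>.\<close>

primrec value_from_end :: "nat \<Rightarrow> 'a \<Rightarrow> real^'n" where
  "value_from_end 0 = X T"
| "value_from_end (Suc n) = (\<lambda>\<omega>. \<chi> k. stage_value G (X (T - Suc n) \<omega>)
     (\<chi> j. real_cond_exp M (F (T - Suc n)) (\<lambda>\<omega>'. value_from_end n \<omega>' $ j) \<omega>) k)"

definition U :: "nat \<Rightarrow> 'a \<Rightarrow> real^'n" where
  "U u = value_from_end (T - u)"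

definition P :: "nat \<Rightarrow> 'a \<Rightarrow> real^'n" where
  "P u \<omega> = (\<chi> j. real_cond_exp M (F u) (\<lambda>\<omega>'. U (Suc u) \<omega>' $ j) \<omega>)"

lemma U_T: "U T = X T"
  by (simp add: U_def)

lemma U_stage:
  assumes "u < T"
  shows "U u \<omega> $ k = stage_value G (X u \<omega>) (P u \<omega>) k"
proof -
  have "T - u = Suc (T - Suc u)" "T - Suc (T - Suc u) = u" using assms by auto
  then show ?thesis by (simp add: U_def P_def)
qed

lemma P_borel: "(\<lambda>\<omega>. P u \<omega> $ k) \<in> borel_measurable (F u)"
  by (simp add: P_def)

lemma U_nth:
  assumes "u \<le> T"
  shows "(\<lambda>\<omega>. U u \<omega> $ k) \<in> borel_measurable (F u) \<and> integrable M (\<lambda>\<omega>. U u \<omega> $ k)"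
  using assms
proof (induction arbitrary: k rule: inc_induct)
  case base
  then show ?case by (simp add: U_T X_nth)
next
  case (step u)
  have u: "u \<le> T" using step.hyps by simp
  note [measurable] = X_nth_borel[OF u] P_borel[of u]
  have P_int: "integrable M (\<lambda>\<omega>. P u \<omega> $ j)" for j
    using sigma_finite_subalgebra.real_cond_exp_int(1)[OF sigma_finite_subalgebra_F] step.IH
    by (simp add: P_def)
  have eq: "(\<lambda>\<omega>. U u \<omega> $ k) = (\<lambda>\<omega>. max (X u \<omega> $ k)
      (MIN E\<in>{E. k \<notin> E}. affine_payoff G E (X u \<omega>) (P u \<omega>) k))"
    using step.hyps by (simp add: U_stage stage_value_def)
  have "(\<lambda>\<omega>. affine_payoff G E (X u \<omega>) (P u \<omega>) k) \<in> borel_measurable (F u)" for E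
    unfolding affine_payoff_def by measurable
  then have "(\<lambda>\<omega>. U u \<omega> $ k) \<in> borel_measurable (F u)"
    unfolding eq by (intro borel_measurable_max borel_measurable_Min X_nth_borel[OF u]) auto
  moreover have "integrable M (\<lambda>\<omega>. affine_payoff G E (X u \<omega>) (P u \<omega>) k)" for E
    unfolding affine_payoff_def
    by (intro Bochner_Integration.integrable_add Bochner_Integration.integrable_sum
        integrable_mult_right Bochner_Integration.integrable_diff P_int X_nth_integrable[OF u])
  then have "integrable M (\<lambda>\<omega>. U u \<omega> $ k)"
    unfolding eq by (intro integrable_max integrable_MIN X_nth_integrable[OF u]) auto
  ultimately show ?case by simp
qed

lemma U_borel: "u \<le> T \<Longrightarrow> (\<lambda>\<omega>. U u \<omega> $ k) \<in> borel_measurable (F u)"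
  and U_integrable: "u \<le> T \<Longrightarrow> integrable M (\<lambda>\<omega>. U u \<omega> $ k)"
  using U_nth by auto

text \<open>In discrete time, \<open>Suc v \<le> \<tau>\<close> is \<open>v < \<tau>\<close>, which
  is already decided at time \<open>v\<close>.\<close>

lemma pred_stopping_time:
  assumes "stopping_time F \<tau>"
  shows "Measurable.pred (F u) (\<lambda>\<omega>. u \<le> \<tau> \<omega>)"
    and "Measurable.pred (F u) (\<lambda>\<omega>. \<tau> \<omega> = u)"
proof -
  show ge: "Measurable.pred (F u) (\<lambda>\<omega>. u \<le> \<tau> \<omega>)"
  proof (cases u)
    case (Suc v)
    have "Measurable.pred (F v) (\<lambda>\<omega>. v < \<tau> \<omega>)" by (rule stopping_timeD2[OF assms])
    then have "Measurable.pred (F u) (\<lambda>\<omega>. v < \<tau> \<omega>)"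
      by (rule measurable_from_subalg[OF subalg_mono, rotated]) (simp add: Suc)
    then show ?thesis by (simp add: Suc Suc_le_eq)
  qed simp
  have [measurable]: "Measurable.pred (F u) (\<lambda>\<omega>. \<tau> \<omega> \<le> u)" by (rule stopping_timeD[OF assms])
  have "Measurable.pred (F u) (\<lambda>\<omega>. \<tau> \<omega> \<le> u \<and> u \<le> \<tau> \<omega>)" using ge by measurable
  then show "Measurable.pred (F u) (\<lambda>\<omega>. \<tau> \<omega> = u)" by (simp add: eq_iff)
qed

text \<open>The first time from \<open>t\<close> on at which exercising is worth the candidate
  value; forced exercise at \<open>T\<close> makes the search succeed when
  \<open>t \<le> T\<close>.\<close>

definition optimal :: "nat \<Rightarrow> 'n \<Rightarrow> 'a \<Rightarrow> nat" where
  "optimal t k \<omega> = (LEAST u. t \<le> u \<and> (u = T \<or> U u \<omega> $ k = X u \<omega> $ k))"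

lemma optimal_bounds:
  assumes "t \<le> T"
  shows "t \<le> optimal t k \<omega>" "optimal t k \<omega> \<le> T"
    and "optimal t k \<omega> = T \<or> U (optimal t k \<omega>) \<omega> $ k = X (optimal t k \<omega>) \<omega> $ k"
proof -
  let ?Q = "\<lambda>u. t \<le> u \<and> (u = T \<or> U u \<omega> $ k = X u \<omega> $ k)"
  have "?Q T" using assms by simp
  then have "?Q (optimal t k \<omega>)" "optimal t k \<omega> \<le> T"
    unfolding optimal_def by (rule LeastI, rule Least_le)
  then show "t \<le> optimal t k \<omega>" "optimal t k \<omega> \<le> T"
    "optimal t k \<omega> = T \<or> U (optimal t k \<omega>) \<omega> $ k = X (optimal t k \<omega>) \<omega> $ k" by auto
qed

lemma optimal_le:
  "t \<le> u \<Longrightarrow> U u \<omega> $ k = X u \<omega> $ k \<Longrightarrow> optimal t k \<omega> \<le> u"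
  unfolding optimal_def by (rule Least_le) simp

lemma optimal_strategy:
  assumes "t \<le> T"
  shows "optimal t k \<in> strategies M F T t"
proof -
  have "stopping_time F (optimal t k)"
  proof
    fix v
    \<comment> \<open>Writes the event as a finite union of events known by time
      \<open>v\<close>.\<close>
    have eq: "optimal t k \<omega> \<le> v \<longleftrightarrow> (\<exists>u\<in>{t..min v T}. u = T \<or> U u \<omega> $ k = X u \<omega> $ k)" for \<omega>
    proof
      assume "optimal t k \<omega> \<le> v"
      then show "\<exists>u\<in>{t..min v T}. u = T \<or> U u \<omega> $ k = X u \<omega> $ k"
        using optimal_bounds[OF assms, of k \<omega>] by (intro bexI[of _ "optimal t k \<omega>"]) auto
    next
      assume "\<exists>u\<in>{t..min v T}. u = T \<or> U u \<omega> $ k = X u \<omega> $ k"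
      then show "optimal t k \<omega> \<le> v"
        using optimal_bounds(2)[OF assms, of k \<omega>] optimal_le[of t _ \<omega> k] by fastforce
    qed
    have "Measurable.pred (F v) (\<lambda>\<omega>. U u \<omega> $ k = X u \<omega> $ k)" if "u \<in> {t..min v T}" for u
    proof -
      have u: "u \<le> T" "u \<le> v" using that by auto
      have [measurable]: "(\<lambda>\<omega>. U u \<omega> $ k) \<in> borel_measurable (F v)"
        "(\<lambda>\<omega>. X u \<omega> $ k) \<in> borel_measurable (F v)"
        using measurable_from_subalg[OF subalg_mono[OF u(2)]] U_borel X_nth_borel u(1) by blast+
      show ?thesis by measurable
    qed
    then show "Measurable.pred (F v) (\<lambda>\<omega>. optimal t k \<omega> \<le> v)"
      unfolding eq by (intro pred_intros_finite pred_intros_logic) auto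
  qed
  then show ?thesis using optimal_bounds[OF assms] by (simp add: strategies_def)
qed

text \<open>Covers both the truncated continuation inside the recursion of \<open>sag_value\<close>
  and \<open>sag_value\<close> itself, hence no condition at \<open>t\<close>. Measurability is a
  separate requirement: conditional expectations are compared only for measurable payoffs.\<close>

definition continuation_version :: "nat \<Rightarrow> (nat \<Rightarrow> 'a \<Rightarrow> real^'n) \<Rightarrow> bool" where
  "continuation_version t W \<longleftrightarrow> (\<forall>u. t < u \<and> u \<le> T \<longrightarrow>
     (\<forall>k. (\<lambda>\<omega>. W u \<omega> $ k) \<in> borel_measurable M) \<and> (AE \<omega> in M. W u \<omega> = U u \<omega>))"

end

section \<open>Conditional gains along a fixed strategy profile\<close>

locale strategy_profile = affine_game G M F T X
  for G :: "real^'n^'n" and M :: "'a measure" and F T X +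
  fixes t :: nat and s :: "'n \<Rightarrow> 'a \<Rightarrow> nat"
  assumes t_le: "t \<le> T" and s: "\<And>i. s i \<in> strategies M F T t"
begin

definition alive :: "nat \<Rightarrow> 'a \<Rightarrow> bool" where
  "alive u \<omega> \<longleftrightarrow> (\<forall>i. u \<le> s i \<omega>)"

definition exercising :: "nat \<Rightarrow> 'a \<Rightarrow> 'n set" where
  "exercising u \<omega> = {i. s i \<omega> = u}"

definition terminal_payoff :: "(nat \<Rightarrow> 'a \<Rightarrow> real^'n) \<Rightarrow> 'n \<Rightarrow> 'a \<Rightarrow> real" where
  "terminal_payoff W k \<omega> = (let u = first_exercise s \<omega>; E = exercisers s \<omega> in
     if k \<in> E then X u \<omega> $ k else affine_payoff G E (X u \<omega>) (W (Suc u) \<omega>) k)"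

definition gain :: "(nat \<Rightarrow> 'a \<Rightarrow> real^'n) \<Rightarrow> nat \<Rightarrow> 'n \<Rightarrow> 'a \<Rightarrow> real" where
  "gain W u k \<omega> = of_bool (alive u \<omega>) *
     (stage_payoff G (exercising u \<omega>) (X u \<omega>) (W (Suc u) \<omega>) k - W u \<omega> $ k)"

lemma outcome_eq: "outcome_with M F X G W t s k = real_cond_exp M (F t) (terminal_payoff W k)"
  by (simp add: outcome_with_def terminal_payoff_def[abs_def] Let_def)

lemma s_bounds: "\<omega> \<in> space M \<Longrightarrow> t \<le> s i \<omega> \<and> s i \<omega> \<le> T"
  using s by (simp add: strategies_def)

lemma alive_iff: "alive u \<omega> \<longleftrightarrow> u \<le> first_exercise s \<omega>"
  by (simp add: alive_def first_exercise_def)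

lemma first_exercise_attained: "\<exists>i. s i \<omega> = first_exercise s \<omega>"
proof -
  have "first_exercise s \<omega> \<in> range (\<lambda>i. s i \<omega>)"
    unfolding first_exercise_def by (intro Min_in) auto
  then show ?thesis by auto
qed

lemma exercising_first: "exercising (first_exercise s \<omega>) \<omega> = exercisers s \<omega>"
  by (simp add: exercising_def exercisers_def)

lemma exercising_before: "u < first_exercise s \<omega> \<Longrightarrow> exercising u \<omega> = {}"
  using alive_iff[of "first_exercise s \<omega>" \<omega>]
  by (auto simp: exercising_def alive_def dest: leD)

text \<open>The payoff telescopes: while nobody exercises, \<open>gain\<close> is the increment of \<open>W\<close>.\<close>

lemma terminal_payoff_telescope:
  assumes \<omega>: "\<omega> \<in> space M"
  shows "terminal_payoff W k \<omega> = W t \<omega> $ k + (\<Sum>u=t..<T. gain W u k \<omega>)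
     + of_bool (alive T \<omega>) * (X T \<omega> $ k - W T \<omega> $ k)"
proof -
  define \<sigma> where "\<sigma> = first_exercise s \<omega>"
  have \<sigma>: "t \<le> \<sigma>" "\<sigma> \<le> T"
    using first_exercise_attained[of \<omega>] s_bounds[OF \<omega>] unfolding \<sigma>_def by metis+
  have before: "gain W u k \<omega> = W (Suc u) \<omega> $ k - W u \<omega> $ k" if "u < \<sigma>" for u
    using that
    by (simp add: gain_def alive_iff exercising_before \<sigma>_def stage_payoff_def affine_payoff_def)
  have after: "gain W u k \<omega> = 0" if "\<sigma> < u" for u
    using that by (simp add: gain_def alive_iff \<sigma>_def)
  have "(\<Sum>u=t..<\<sigma>. gain W u k \<omega>) = (\<Sum>u=t..<\<sigma>. W (Suc u) \<omega> $ k - W u \<omega> $ k)"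
    by (intro sum.cong) (auto simp: before)
  also have "\<dots> = W \<sigma> \<omega> $ k - W t \<omega> $ k"
    using \<sigma>(1) by (rule sum_Suc_diff')
  finally have sum_before: "(\<Sum>u=t..<\<sigma>. gain W u k \<omega>) = W \<sigma> \<omega> $ k - W t \<omega> $ k" .
  show ?thesis
  proof (cases "\<sigma> = T")
    \<comment> \<open>Here the sum ends at \<open>W T\<close>, and the last summand of the claim
      replaces it by \<open>X T\<close>. For \<open>U\<close> this correction vanishes by
      \<open>U_T\<close>.\<close>
    case True
    then have "s i \<omega> = T" for i
      using alive_iff[of T \<omega>] s_bounds[OF \<omega>, of i] by (simp add: \<sigma>_def alive_def antisym)
    then have "k \<in> exercisers s \<omega>"
      using True by (simp add: exercisers_def \<sigma>_def)
    then show ?thesis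
      using True sum_before by (simp add: terminal_payoff_def alive_iff \<sigma>_def[symmetric])
  next
    case False
    then have "\<sigma> < T" using \<sigma> by simp
    then have "(\<Sum>u=t..<T. gain W u k \<omega>) =
        (\<Sum>u=t..<\<sigma>. gain W u k \<omega>) + gain W \<sigma> k \<omega> + (\<Sum>u=Suc \<sigma>..<T. gain W u k \<omega>)"
      using sum.atLeastLessThan_concat[of t \<sigma> T "\<lambda>u. gain W u k \<omega>"] \<sigma>(1)
        sum.atLeast_Suc_lessThan[of \<sigma> T "\<lambda>u. gain W u k \<omega>"] by simp
    also have "(\<Sum>u=Suc \<sigma>..<T. gain W u k \<omega>) = 0" by (intro sum.neutral) (auto simp: after)
    also have "gain W \<sigma> k \<omega> =
        stage_payoff G (exercisers s \<omega>) (X \<sigma> \<omega>) (W (Suc \<sigma>) \<omega>) k - W \<sigma> \<omega> $ k"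
      by (simp add: gain_def alive_iff \<sigma>_def exercising_first)
    finally show ?thesis
      using \<open>\<sigma> < T\<close> sum_before
      by (simp add: terminal_payoff_def stage_payoff_def alive_iff \<sigma>_def[symmetric] Let_def)
  qed
qed

text \<open>All that a stage needs to know of the strategies, as one variable with finitely many
  values: any real function of it is bounded and measurable at time \<open>u\<close>.\<close>

definition status :: "nat \<Rightarrow> 'a \<Rightarrow> bool \<times> 'n set" where
  "status u \<omega> = (alive u \<omega>, exercising u \<omega>)"

lemma status_measurable: "status u \<in> measurable (F u) (count_space UNIV)"
proof -
  have st: "stopping_time F (s i)" for i using s by (simp add: strategies_def)
  have [measurable]: "Measurable.pred (F u) (\<lambda>\<omega>. u \<le> s i \<omega>)"
    "Measurable.pred (F u) (\<lambda>\<omega>. s i \<omega> = u)" for i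
    by (rule pred_stopping_time[OF st])+
  have "status u -` {z} \<inter> space (F u) \<in> sets (F u)" for z
  proof -
    have "status u -` {z} \<inter> space (F u) = {\<omega> \<in> space (F u).
        (fst z \<longleftrightarrow> (\<forall>i. u \<le> s i \<omega>)) \<and> (\<forall>i. i \<in> snd z \<longleftrightarrow> s i \<omega> = u)}"
      by (cases z) (auto simp: status_def alive_def exercising_def)
    also have "\<dots> \<in> sets (F u)" by measurable
    finally show ?thesis .
  qed
  then show ?thesis by (simp add: measurable_count_space_eq2)
qed

lemma status_measurable_M: "status u \<in> measurable M (count_space UNIV)"
  by (rule measurable_from_subalg[OF subalgebra_F status_measurable])

lemma status_fun_borel:
  fixes g :: "bool \<times> 'n set \<Rightarrow> real"
  shows "(\<lambda>\<omega>. g (status u \<omega>)) \<in> borel_measurable (F u)"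
  by (rule measurable_compose[OF status_measurable]) simp

definition held_coeff :: "'n \<Rightarrow> 'n \<Rightarrow> bool \<times> 'n set \<Rightarrow> real" where
  "held_coeff k j z = of_bool (fst z) * (of_bool (j = k) - payoff_coeff G (snd z) k j)"

definition exercised_coeff :: "'n \<Rightarrow> 'n \<Rightarrow> bool \<times> 'n set \<Rightarrow> real" where
  "exercised_coeff k j z = of_bool (fst z) * payoff_coeff G (snd z) k j"

lemma alive_stage_payoff:
  "of_bool (alive u \<omega>) * stage_payoff G (exercising u \<omega>) x v k =
     (\<Sum>j\<in>UNIV. exercised_coeff k j (status u \<omega>) * x $ j)
     + (\<Sum>j\<in>UNIV. held_coeff k j (status u \<omega>) * v $ j)"
proof -
  have "v $ k = (\<Sum>j\<in>UNIV. of_bool (j = k) * v $ j)"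
    using sum.delta[of UNIV k "($) v"] by (simp add: of_bool_def if_distrib[of "\<lambda>x. x * _"] cong: if_cong)
  then show ?thesis
    by (simp add: stage_payoff_coeff held_coeff_def exercised_coeff_def status_def
        algebra_simps sum.distrib sum_subtractf)
qed

lemma gain_coeff:
  "gain W u k \<omega> = (\<Sum>j\<in>UNIV. exercised_coeff k j (status u \<omega>) * X u \<omega> $ j)
     - of_bool (fst (status u \<omega>)) * W u \<omega> $ k
     + (\<Sum>j\<in>UNIV. held_coeff k j (status u \<omega>) * W (Suc u) \<omega> $ j)"
  by (simp add: gain_def right_diff_distrib alive_stage_payoff) (simp add: status_def)

lemma gain_borel:
  assumes "u < T" and [measurable]: "\<And>k. (\<lambda>\<omega>. W u \<omega> $ k) \<in> borel_measurable M"
    "\<And>k. (\<lambda>\<omega>. W (Suc u) \<omega> $ k) \<in> borel_measurable M"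
  shows "gain W u k \<in> borel_measurable M"
proof -
  have [measurable]: "(\<lambda>\<omega>. g (status u \<omega>)) \<in> borel_measurable M"
    for g :: "bool \<times> 'n set \<Rightarrow> real"
    by (rule measurable_from_subalg[OF subalgebra_F status_fun_borel])
  have [measurable]: "(\<lambda>\<omega>. X u \<omega> $ j) \<in> borel_measurable M" for j
    using assms(1) by (intro measurable_from_subalg[OF subalgebra_F X_nth_borel]) simp
  have "(\<lambda>\<omega>. of_bool (fst (status u \<omega>)) :: real) \<in> borel_measurable M"
    by measurable
  note [measurable] = this
  show ?thesis
    unfolding gain_coeff[abs_def] by measurable
qed

lemma gain_U_integrable:
  assumes "u < T"
  shows "integrable M (gain U u k)"
  unfolding gain_coeff[abs_def] using assms
  by (intro Bochner_Integration.integrable_add Bochner_Integration.integrable_diff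
      Bochner_Integration.integrable_sum X_nth_integrable U_integrable
      integrable_finite_valued_mult[OF status_measurable_M, of _ "exercised_coeff _ _"]
      integrable_finite_valued_mult[OF status_measurable_M, of _ "held_coeff _ _"]
      integrable_finite_valued_mult[OF status_measurable_M, of _ "\<lambda>z. of_bool (fst z)"]) auto

text \<open>By \<open>gain_coeff\<close>, the next value enters linearly with coefficients known at
  time \<open>u\<close>. These can be taken out of the conditional expectation, which leaves
  \<open>P u\<close>.\<close>

lemma cond_exp_gain:
  assumes "u < T"
  shows "AE \<omega> in M. real_cond_exp M (F u) (gain U u k) \<omega> = of_bool (alive u \<omega>) *
     (stage_payoff G (exercising u \<omega>) (X u \<omega>) (P u \<omega>) k - U u \<omega> $ k)"
proof -
  interpret sigma_finite_subalgebra M "F u" by (rule sigma_finite_subalgebra_F)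
  let ?A = "\<lambda>\<omega>. (\<Sum>j\<in>UNIV. exercised_coeff k j (status u \<omega>) * X u \<omega> $ j)
     - of_bool (fst (status u \<omega>)) * U u \<omega> $ k"
  let ?B = "\<lambda>j \<omega>. held_coeff k j (status u \<omega>) * U (Suc u) \<omega> $ j"
  have u: "u \<le> T" "Suc u \<le> T" using assms by auto
  have A_int: "integrable M ?A"
    by (intro Bochner_Integration.integrable_diff
        Bochner_Integration.integrable_sum X_nth_integrable U_integrable u
        integrable_finite_valued_mult[OF status_measurable_M, of _ "exercised_coeff _ _"]
        integrable_finite_valued_mult[OF status_measurable_M, of _ "\<lambda>z. of_bool (fst z)"])
  have A_borel: "?A \<in> borel_measurable (F u)"
    by (intro borel_measurable_diff borel_measurable_sum borel_measurable_times
        status_fun_borel[of "\<lambda>z. of_bool (fst z)"] status_fun_borel X_nth_borel U_borel u)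
  have B_int: "integrable M (?B j)" for j
    by (intro integrable_finite_valued_mult[OF status_measurable_M] U_integrable u)
  have "AE \<omega> in M. real_cond_exp M (F u) (\<lambda>\<omega>. ?A \<omega> + (\<Sum>j\<in>UNIV. ?B j \<omega>)) \<omega> =
      real_cond_exp M (F u) ?A \<omega> + real_cond_exp M (F u) (\<lambda>\<omega>. \<Sum>j\<in>UNIV. ?B j \<omega>) \<omega>"
    by (intro real_cond_exp_add A_int Bochner_Integration.integrable_sum B_int)
  moreover have "AE \<omega> in M. real_cond_exp M (F u) ?A \<omega> = ?A \<omega>"
    using A_int A_borel by (rule real_cond_exp_F_meas)
  moreover have "AE \<omega> in M. real_cond_exp M (F u) (\<lambda>\<omega>. \<Sum>j\<in>UNIV. ?B j \<omega>) \<omega> =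
      (\<Sum>j\<in>UNIV. real_cond_exp M (F u) (?B j) \<omega>)"
    using B_int by (rule real_cond_exp_sum)
  moreover have "AE \<omega> in M. \<forall>j. real_cond_exp M (F u) (?B j) \<omega> =
      held_coeff k j (status u \<omega>) * P u \<omega> $ j"
  proof -
    have "AE \<omega> in M. real_cond_exp M (F u) (?B j) \<omega> =
      held_coeff k j (status u \<omega>) * P u \<omega> $ j" for j
      unfolding P_def vec_lambda_beta
      by (rule real_cond_exp_mult[OF status_fun_borel _ B_int])
        (rule borel_measurable_integrable[OF U_integrable[OF u(2)]])
    then show ?thesis by (simp add: AE_all_countable)
  qed
  ultimately show ?thesis
  proof eventually_elim
    case (elim \<omega>)
    then show ?case
      unfolding gain_coeff[abs_def] right_diff_distrib alive_stage_payoff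
      by (simp add: status_def)
  qed
qed

definition cond_gain :: "nat \<Rightarrow> 'n \<Rightarrow> 'a \<Rightarrow> real" where
  "cond_gain u k = real_cond_exp M (F u) (gain U u k)"

lemma cond_gain_integrable: "u < T \<Longrightarrow> integrable M (cond_gain u k)"
  unfolding cond_gain_def
  by (intro sigma_finite_subalgebra.real_cond_exp_int(1)[OF sigma_finite_subalgebra_F] gain_U_integrable)

text \<open>Submartingale half of the argument: the optimal player's stage decision meets the
  hypothesis of \<open>stage_value_le_stage_payoff\<close>, whatever the others do.\<close>

lemma cond_gain_nonneg:
  assumes k: "s k = optimal t k" and u: "t \<le> u" "u < T"
  shows "AE \<omega> in M. 0 \<le> cond_gain u k \<omega>"
  using cond_exp_gain[OF u(2), of k]
proof eventually_elim
  case (elim \<omega>)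
  have "U u \<omega> $ k \<le> stage_payoff G (exercising u \<omega>) (X u \<omega>) (P u \<omega>) k" if "alive u \<omega>"
  proof -
    \<comment> \<open>While the game is alive, \<open>k\<close> has not stopped before
      \<open>u\<close>, so reaching \<open>U = X\<close> at \<open>u\<close> means stopping exactly
      there.\<close>
    have "k \<in> exercising u \<omega> \<longleftrightarrow> U u \<omega> $ k = X u \<omega> $ k"
    proof
      assume "k \<in> exercising u \<omega>"
      then have "optimal t k \<omega> = u" by (simp add: exercising_def k)
      then show "U u \<omega> $ k = X u \<omega> $ k" using optimal_bounds(3)[OF t_le, of k \<omega>] u by simp
    next
      assume "U u \<omega> $ k = X u \<omega> $ k"
      then have "s k \<omega> \<le> u" unfolding k by (rule optimal_le[OF u(1)])
      moreover have "u \<le> s k \<omega>" using that by (simp add: alive_def)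
      ultimately show "k \<in> exercising u \<omega>" by (simp add: exercising_def)
    qed
    then show ?thesis
      unfolding U_stage[OF u(2)] by (intro stage_value_le_stage_payoff) auto
  qed
  then show ?case by (simp add: elim cond_gain_def)
qed

text \<open>Supermartingale half: the single-stage bound on the total holds for every exercise set,
  so no strategy has to be optimal.\<close>

lemma sum_cond_gain_nonpos:
  assumes u: "u < T"
  shows "AE \<omega> in M. (\<Sum>k\<in>UNIV. cond_gain u k \<omega>) \<le> 0"
proof -
  have "AE \<omega> in M. \<forall>k. cond_gain u k \<omega> = of_bool (alive u \<omega>) *
     (stage_payoff G (exercising u \<omega>) (X u \<omega>) (P u \<omega>) k - U u \<omega> $ k)"
    using cond_exp_gain[OF u] by (simp add: AE_all_countable cond_gain_def)
  then show ?thesis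
  proof eventually_elim
    case (elim \<omega>)
    have "(\<Sum>k\<in>UNIV. stage_payoff G (exercising u \<omega>) (X u \<omega>) (P u \<omega>) k) \<le> (\<Sum>k\<in>UNIV. U u \<omega> $ k)"
      unfolding U_stage[OF u] by (rule sum_stage_payoff_le[OF column_sums])
    then show ?case
      by (simp add: elim sum_distrib_left[symmetric] sum_subtractf)
  qed
qed

lemma outcome_decomposition:
  assumes W: "continuation_version t W"
  shows "AE \<omega> in M. outcome_with M F X G W t s k \<omega> =
    U t \<omega> $ k + (\<Sum>u=t..<T. real_cond_exp M (F t) (cond_gain u k) \<omega>)"
proof -
  interpret sigma_finite_subalgebra M "F t" by (rule sigma_finite_subalgebra_F)
  \<comment> \<open>Nothing is known of \<open>W\<close> at \<open>t\<close>, but the telescoping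
    sum starts there. The payoff reads \<open>W\<close> only after the first exercise, hence after
    \<open>t\<close>, so this change leaves it intact.\<close>
  define W' where "W' = W(t := U t)"
  let ?R = "\<lambda>W \<omega>. W t \<omega> $ k + (\<Sum>u=t..<T. gain W u k \<omega>)
     + of_bool (alive T \<omega>) * (X T \<omega> $ k - W T \<omega> $ k)"
  let ?R' = "\<lambda>\<omega>. U t \<omega> $ k + (\<Sum>u=t..<T. gain U u k \<omega>)"
  have W'_borel: "(\<lambda>\<omega>. W' u \<omega> $ k) \<in> borel_measurable M" if "t \<le> u" "u \<le> T" for u k
    using that W U_integrable by (auto simp: W'_def continuation_version_def)
  have "AE \<omega> in M. W' u \<omega> = U u \<omega>" if "u \<in> {t..T}" for u
    using that W by (auto simp: W'_def continuation_version_def)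
  then have AE_W': "AE \<omega> in M. \<forall>u\<in>{t..T}. W' u \<omega> = U u \<omega>"
    by (subst AE_ball_countable) auto
  have payoff: "terminal_payoff W k \<omega> = ?R W' \<omega>" if "\<omega> \<in> space M" for \<omega>
  proof -
    have "t \<le> first_exercise s \<omega>"
      using s_bounds[OF that] first_exercise_attained[of \<omega>] by metis
    then have "terminal_payoff W k \<omega> = terminal_payoff W' k \<omega>"
      by (simp add: terminal_payoff_def W'_def Let_def)
    then show ?thesis using terminal_payoff_telescope[OF that] by simp
  qed
  have "(\<lambda>\<omega>. of_bool (alive T \<omega>) :: real) \<in> borel_measurable M"
    using measurable_from_subalg[OF subalgebra_F status_fun_borel[of "\<lambda>z. of_bool (fst z)" T]]
    by (simp add: status_def)
  then have "?R W' \<in> borel_measurable M"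
    using t_le
    by (intro borel_measurable_add borel_measurable_sum borel_measurable_times
        borel_measurable_diff gain_borel W'_borel borel_measurable_integrable[OF X_nth_integrable]) auto
  then have payoff_borel: "terminal_payoff W k \<in> borel_measurable M"
    by (subst measurable_cong[OF payoff])
  \<comment> \<open>Extension by zero from \<open>T\<close> on makes every member of the family
    integrable, as the summation rule for conditional expectations demands.\<close>
  have gain_int: "integrable M (if u < T then gain U u k else (\<lambda>_. 0))" for u
    using gain_U_integrable by auto
  have sum_eq: "(\<Sum>u=t..<T. gain U u k \<omega>) =
      (\<Sum>u=t..<T. (if u < T then gain U u k else (\<lambda>_. 0)) \<omega>)" for \<omega>
    by (intro sum.cong) auto
  have R'_int: "integrable M ?R'"
    using t_le
    by (intro Bochner_Integration.integrable_add Bochner_Integration.integrable_sum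
        gain_U_integrable U_integrable) auto
  have "AE \<omega> in M. terminal_payoff W k \<omega> = ?R' \<omega>"
    using AE_W' AE_space
  proof eventually_elim
    case (elim \<omega>)
    have "gain W' u k \<omega> = gain U u k \<omega>" if "u \<in> {t..<T}" for u
      using elim(1) that by (simp add: gain_def)
    then show ?case
      using payoff[OF elim(2)] elim(1) t_le by (simp add: U_T)
  qed
  then have "AE \<omega> in M. outcome_with M F X G W t s k \<omega> = real_cond_exp M (F t) ?R' \<omega>"
    unfolding outcome_eq
    by (rule real_cond_exp_cong[OF _ payoff_borel borel_measurable_integrable[OF R'_int]])
  moreover have "AE \<omega> in M. real_cond_exp M (F t) ?R' \<omega> = real_cond_exp M (F t) (\<lambda>\<omega>. U t \<omega> $ k) \<omega>
      + real_cond_exp M (F t) (\<lambda>\<omega>. \<Sum>u=t..<T. gain U u k \<omega>) \<omega>"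
    by (intro real_cond_exp_add U_integrable t_le Bochner_Integration.integrable_sum
        gain_U_integrable) auto
  moreover have "AE \<omega> in M. real_cond_exp M (F t) (\<lambda>\<omega>. U t \<omega> $ k) \<omega> = U t \<omega> $ k"
    by (intro real_cond_exp_F_meas U_integrable U_borel t_le)
  moreover have "AE \<omega> in M. real_cond_exp M (F t) (\<lambda>\<omega>. \<Sum>u=t..<T. gain U u k \<omega>) \<omega> =
      (\<Sum>u=t..<T. real_cond_exp M (F t) (gain U u k) \<omega>)"
  proof -
    have "AE \<omega> in M. real_cond_exp M (F t) (\<lambda>\<omega>. \<Sum>u=t..<T. gain U u k \<omega>) \<omega> =
      (\<Sum>u=t..<T. real_cond_exp M (F t) (if u < T then gain U u k else (\<lambda>_. 0)) \<omega>)"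
      unfolding sum_eq using gain_int by (rule real_cond_exp_sum)
    also have "(\<lambda>\<omega>. \<Sum>u=t..<T. real_cond_exp M (F t) (if u < T then gain U u k else (\<lambda>_. 0)) \<omega>) =
        (\<lambda>\<omega>. \<Sum>u=t..<T. real_cond_exp M (F t) (gain U u k) \<omega>)"
      by (intro ext sum.cong) auto
    finally show ?thesis .
  qed
  moreover have "AE \<omega> in M. \<forall>u\<in>{t..<T}. real_cond_exp M (F t) (cond_gain u k) \<omega> =
      real_cond_exp M (F t) (gain U u k) \<omega>"
  proof (subst AE_ball_countable)
    show "\<forall>u\<in>{t..<T}. AE \<omega> in M. real_cond_exp M (F t) (cond_gain u k) \<omega> =
        real_cond_exp M (F t) (gain U u k) \<omega>"
      unfolding cond_gain_def
      by (intro ballI real_cond_exp_nested_subalg subalgebra_F subalg_mono gain_U_integrable) auto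
  qed auto
  ultimately show ?thesis by eventually_elim simp
qed

lemma outcome_ge:
  assumes W: "continuation_version t W" and k: "s k = optimal t k"
  shows "AE \<omega> in M. U t \<omega> $ k \<le> outcome_with M F X G W t s k \<omega>"
proof -
  interpret sigma_finite_subalgebra M "F t" by (rule sigma_finite_subalgebra_F)
  have "AE \<omega> in M. \<forall>u\<in>{t..<T}. 0 \<le> real_cond_exp M (F t) (cond_gain u k) \<omega>"
  proof (subst AE_ball_countable)
    show "\<forall>u\<in>{t..<T}. AE \<omega> in M. 0 \<le> real_cond_exp M (F t) (cond_gain u k) \<omega>"
      by (intro ballI real_cond_exp_pos cond_gain_nonneg k
          borel_measurable_integrable[OF cond_gain_integrable]) auto
  qed auto
  with outcome_decomposition[OF W, of k] show ?thesis
    by eventually_elim (auto intro!: sum_nonneg)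
qed

lemma sum_outcome_le:
  assumes W: "continuation_version t W"
  shows "AE \<omega> in M. (\<Sum>k\<in>UNIV. outcome_with M F X G W t s k \<omega>) \<le> (\<Sum>k\<in>UNIV. U t \<omega> $ k)"
proof -
  interpret sigma_finite_subalgebra M "F t" by (rule sigma_finite_subalgebra_F)
  have "AE \<omega> in M. (\<Sum>k\<in>UNIV. real_cond_exp M (F t) (cond_gain u k) \<omega>) \<le> 0" if u: "u \<in> {t..<T}" for u
  proof -
    have "AE \<omega> in M. real_cond_exp M (F t) (\<lambda>\<omega>. \<Sum>k\<in>UNIV. cond_gain u k \<omega>) \<omega> =
        (\<Sum>k\<in>UNIV. real_cond_exp M (F t) (cond_gain u k) \<omega>)"
      using u by (intro real_cond_exp_sum cond_gain_integrable) auto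
    moreover have "AE \<omega> in M. real_cond_exp M (F t) (\<lambda>\<omega>. \<Sum>k\<in>UNIV. cond_gain u k \<omega>) \<omega> \<le>
        real_cond_exp M (F t) (\<lambda>_. 0) \<omega>"
      using u
      by (intro real_cond_exp_mono sum_cond_gain_nonpos Bochner_Integration.integrable_sum
          cond_gain_integrable) auto
    moreover have "AE \<omega> in M. real_cond_exp M (F t) (\<lambda>_. 0) \<omega> = 0"
      by (intro real_cond_exp_F_meas) auto
    ultimately show ?thesis by eventually_elim simp
  qed
  then have "AE \<omega> in M. \<forall>u\<in>{t..<T}. (\<Sum>k\<in>UNIV. real_cond_exp M (F t) (cond_gain u k) \<omega>) \<le> 0"
    by (subst AE_ball_countable) auto
  moreover have "AE \<omega> in M. \<forall>k. outcome_with M F X G W t s k \<omega> =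
    U t \<omega> $ k + (\<Sum>u=t..<T. real_cond_exp M (F t) (cond_gain u k) \<omega>)"
    using outcome_decomposition[OF W] by (simp add: AE_all_countable)
  ultimately show ?thesis
  proof eventually_elim
    case (elim \<omega>)
    have "(\<Sum>k\<in>UNIV. \<Sum>u=t..<T. real_cond_exp M (F t) (cond_gain u k) \<omega>) =
        (\<Sum>u=t..<T. \<Sum>k\<in>UNIV. real_cond_exp M (F t) (cond_gain u k) \<omega>)"
      by (rule sum.swap)
    also have "\<dots> \<le> 0" by (rule sum_nonpos) (use elim(1) in blast)
    finally show ?case by (simp add: elim(2) sum.distrib)
  qed
qed

lemma coalition_ge:
  assumes W: "continuation_version t W" and N: "\<And>i. i \<in> N \<Longrightarrow> s i = optimal t i"
  shows "AE \<omega> in M. (\<Sum>i\<in>N. U t \<omega> $ i) \<le> (\<Sum>i\<in>N. outcome_with M F X G W t s i \<omega>)"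
proof -
  have "AE \<omega> in M. \<forall>i\<in>N. U t \<omega> $ i \<le> outcome_with M F X G W t s i \<omega>"
    using outcome_ge[OF W N] by (subst AE_ball_countable) auto
  then show ?thesis by eventually_elim (simp add: sum_mono)
qed

lemma coalition_le:
  assumes W: "continuation_version t W" and N: "\<And>i. i \<notin> N \<Longrightarrow> s i = optimal t i"
  shows "AE \<omega> in M. (\<Sum>i\<in>N. outcome_with M F X G W t s i \<omega>) \<le> (\<Sum>i\<in>N. U t \<omega> $ i)"
proof -
  have "AE \<omega> in M. (\<Sum>i\<in>-N. U t \<omega> $ i) \<le> (\<Sum>i\<in>-N. outcome_with M F X G W t s i \<omega>)"
    by (rule coalition_ge[OF W]) (simp add: N)
  with sum_outcome_le[OF W] show ?thesis
    by eventually_elim (simp add: sum_UNIV_split[of _ N])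
qed

end

section \<open>Identification of the individual and coalition values\<close>

context affine_game
begin

text \<open>By induction on the remaining time, all later values are versions of \<open>U\<close>;
  the optimal stopping times then form a saddle point for player \<open>k\<close> against the
  others.\<close>

lemma sag_value_version:
  assumes "t \<le> T"
  shows "(\<forall>k. (\<lambda>\<omega>. sag_value M F T X G t \<omega> $ k) \<in> borel_measurable M) \<and>
    (AE \<omega> in M. sag_value M F T X G t \<omega> = U t \<omega>)"
  using assms
proof (induction t rule: measure_induct_rule[where f = "\<lambda>t. T - t"])
  case (less t)
  define W where "W u = (if t < u \<and> u \<le> T then sag_value M F T X G u else (\<lambda>_. 0))" for u
  have W: "continuation_version t W"
    using less by (auto simp: continuation_version_def W_def)
  let ?S = "strategies M F T t"
  let ?V = "\<lambda>k. sup_inf M ?S (PiE (- {k}) (\<lambda>_. ?S)) (\<lambda>\<tau> s. outcome_with M F X G W t (s(k := \<tau>)) k)"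
  have eq: "sag_value M F T X G t \<omega> $ k = real_of_ereal (?V k \<omega>)" for \<omega> k
    by (subst sag_value.simps) (simp add: W_def[abs_def] Let_def)
  have V: "?V k \<in> borel_measurable M" "AE \<omega> in M. ?V k \<omega> = ereal (U t \<omega> $ k)" for k
  proof -
    have profile: "strategy_profile G M F T X t (s(k := \<tau>))"
      if "\<tau> \<in> ?S" "s \<in> PiE (- {k}) (\<lambda>_. ?S)" for \<tau> s
      using that less.prems by unfold_locales (auto simp: PiE_mem)
    have opt: "restrict (optimal t) (- {k}) \<in> PiE (- {k}) (\<lambda>_. ?S)"
      using optimal_strategy[OF less.prems] by simp
    have "AE \<omega> in M. U t \<omega> $ k \<le> outcome_with M F X G W t (s(k := optimal t k)) k \<omega>"
      if "s \<in> PiE (- {k}) (\<lambda>_. ?S)" for s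
      using strategy_profile.outcome_ge[OF profile[OF optimal_strategy[OF less.prems] that] W]
      by simp
    \<comment> \<open>Player \<open>k\<close> is held down as the coalition \<open>{k}\<close>: the
      others secure their own sums, and the total is bounded.\<close>
    moreover have "AE \<omega> in M. outcome_with M F X G W t ((restrict (optimal t) (- {k}))(k := \<tau>)) k \<omega> \<le> U t \<omega> $ k"
      if "\<tau> \<in> ?S" for \<tau>
      using strategy_profile.coalition_le[OF profile[OF that opt] W, of "{k}"] by simp
    ultimately show "?V k \<in> borel_measurable M" "AE \<omega> in M. ?V k \<omega> = ereal (U t \<omega> $ k)"
      using saddle_point_value(1,2)[of "\<lambda>\<tau> s. outcome_with M F X G W t (s(k := \<tau>)) k"
          "\<lambda>\<omega>. U t \<omega> $ k" "optimal t k" ?S "PiE (- {k}) (\<lambda>_. ?S)" "restrict (optimal t) (- {k})"]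
        optimal_strategy[OF less.prems] opt borel_measurable_integrable[OF U_integrable[OF less.prems]]
      by (simp_all add: outcome_with_def)
  qed
  have "AE \<omega> in M. \<forall>k. ?V k \<omega> = ereal (U t \<omega> $ k)" using V(2) by (simp add: AE_all_countable)
  then have "AE \<omega> in M. sag_value M F T X G t \<omega> = U t \<omega>"
    by eventually_elim (simp add: vec_eq_iff eq)
  then show ?case using V(1) by (simp add: eq)
qed

lemma coalition_values:
  assumes t: "t \<le> T"
  shows "AE \<omega> in M. coalition_sup_inf M F T X G t N \<omega> = ereal (\<Sum>i\<in>N. U t \<omega> $ i)"
    and "AE \<omega> in M. coalition_inf_sup M F T X G t N \<omega> = ereal (\<Sum>i\<in>N. U t \<omega> $ i)"
proof -
  let ?W = "sag_value M F T X G"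
  let ?S = "coalition_strategies M F T t"
  let ?J = "coalition_outcome M F T X G t N"
  have W: "continuation_version t ?W"
    using sag_value_version by (simp add: continuation_version_def)
  have profile: "strategy_profile G M F T X t (override_on b a N)"
    if "a \<in> ?S N" "b \<in> ?S (- N)" for a b
    using that t by unfold_locales (auto simp: coalition_strategies_def override_on_def PiE_mem)
  have opt: "restrict (optimal t) D \<in> ?S D" for D
    using optimal_strategy[OF t] by (simp add: coalition_strategies_def)
  have J: "?J a b = (\<lambda>\<omega>. \<Sum>i\<in>N. outcome_with M F X G ?W t (override_on b a N) i \<omega>)" for a b
    by (simp add: coalition_outcome_def[abs_def] sag_outcome_def)
  have borel: "?J a b \<in> borel_measurable M" for a b
    unfolding J outcome_with_def by measurable
  have U: "(\<lambda>\<omega>. \<Sum>i\<in>N. U t \<omega> $ i) \<in> borel_measurable M"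
    by (intro borel_measurable_sum borel_measurable_integrable[OF U_integrable[OF t]])
  have ge: "AE \<omega> in M. (\<Sum>i\<in>N. U t \<omega> $ i) \<le> ?J (restrict (optimal t) N) b \<omega>"
    if "b \<in> ?S (- N)" for b
    unfolding J by (rule strategy_profile.coalition_ge[OF profile[OF opt that] W])
      (simp add: override_on_def)
  have le: "AE \<omega> in M. ?J a (restrict (optimal t) (- N)) \<omega> \<le> (\<Sum>i\<in>N. U t \<omega> $ i)"
    if "a \<in> ?S N" for a
    unfolding J by (rule strategy_profile.coalition_le[OF profile[OF that opt] W])
      (simp add: override_on_def)
  note saddle = saddle_point_value(2,3)[of ?J, OF borel U opt ge opt le]
  show "AE \<omega> in M. coalition_sup_inf M F T X G t N \<omega> = ereal (\<Sum>i\<in>N. U t \<omega> $ i)"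
    unfolding coalition_sup_inf_def by (rule saddle(1))
  show "AE \<omega> in M. coalition_inf_sup M F T X G t N \<omega> = ereal (\<Sum>i\<in>N. U t \<omega> $ i)"
    unfolding coalition_inf_sup_def by (rule saddle(2))
qed

end

theorem theorem4p2:
  fixes M :: "'a measure" and F :: "nat \<Rightarrow> 'a measure" and T :: nat
    and X :: "nat \<Rightarrow> 'a \<Rightarrow> real^'n::finite" and G :: "real^'n^'n"
    and t :: nat and N :: "'n set"
  assumes "prob_space M"
    and "filtration (space M) F"
    and "\<And>u. subalgebra M (F u)"
    and "\<And>u. u \<le> T \<Longrightarrow> X u \<in> borel_measurable (F u)"
    and "\<And>u. u \<le> T \<Longrightarrow> integrable M (X u)"
    and "K_dagger_matrix G"
    and "\<And>j. (\<Sum>i\<in>UNIV. G $ i $ j) \<ge> 0"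
    and "t \<le> T"
  shows "(AE \<omega> in M. coalition_sup_inf M F T X G t N \<omega> = coalition_inf_sup M F T X G t N \<omega>) \<and>
         (AE \<omega> in M. coalition_sup_inf M F T X G t N \<omega> = ereal (\<Sum>i\<in>N. sag_value M F T X G t \<omega> $ i))"
proof -
  interpret affine_game G M F T X
    by (intro affine_game.intro affine_game_axioms.intro K_dagger.intro assms)
  note coalition = coalition_values[OF assms(8), of N]
  from coalition have "AE \<omega> in M. coalition_sup_inf M F T X G t N \<omega> = coalition_inf_sup M F T X G t N \<omega>"
    by eventually_elim simp
  moreover have "AE \<omega> in M. sag_value M F T X G t \<omega> = U t \<omega>"
    using sag_value_version[OF assms(8)] by simp
  with coalition(1) have "AE \<omega> in M. coalition_sup_inf M F T X G t N \<omega> =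
      ereal (\<Sum>i\<in>N. sag_value M F T X G t \<omega> $ i)"
    by eventually_elim simp
  ultimately show ?thesis ..
qed

end
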